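(* Let $G$ be a VPT graph and let $h\geq 3$. If $G$ is a minimal non $[h,2,1]$ graph, then $G$ is a split graph without dominated stable vertices.
   Context: All graphs are finite, simple and connected. A VPT representation of $G$ is a tree $T$ together with paths $(P_v)_{v\in V(G)}$ of $T$ such that $uv\in E(G)$ iff $P_u$ and $P_v$ share a vertex; $G$ is VPT if it has one. $[h,2,1]$ is the class of graphs admitting a VPT representation whose host tree has maximum degree at most $h$. A minimal non $[h,2,1]$ graph is a graph $G\notin[h,2,1]$ with $G-v\in[h,2,1]$ for all $v\in V(G)$. A graph is split if $V(G)$ can be partitioned into a stable set $S$ and a clique $K$ (split partition $(S,K)$). A vertex $s$ is a dominated stable vertex if $s\in S$ and there exists $s'\in S$, $s'\neq s$, with $N(s)\subseteq N(s')$. *)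

theory Defs
  imports "Graph_Theory.Graph_Theory"
begin

text \<open>
  Finite simple graphs are the symmetric digraphs of the locale \<^locale>\<open>graph\<close>: an undirected edge
  is a pair of opposite arcs, and adjacency is membership in \<^const>\<open>arcs_ends\<close>.
\<close>

definition neighbors :: "('a, 'b) pre_digraph \<Rightarrow> 'a \<Rightarrow> 'a set" where
  "neighbors G v = {w. (v, w) \<in> arcs_ends G}"

text \<open>
  The library's \<^const>\<open>tree\<close> is not usable for symmetric digraphs, since the walk \<open>a, b, a\<close> along one
  undirected edge counts as a \<^const>\<open>pre_digraph.cycle\<close>. In a symmetric digraph without loops and
  parallel arcs, the cycles of length at least 3 are exactly the undirected cycles.
\<close>

definition undirected_tree :: "('a, 'b) pre_digraph \<Rightarrow> bool" where
  "undirected_tree T \<longleftrightarrow>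
     graph T \<and> connected T \<and> \<not> (\<exists>p. pre_digraph.cycle T p \<and> length p \<ge> 3)"

text \<open>
  A path of the host tree is given by its list of vertices; \<^const>\<open>vpath\<close> excludes the empty list
  and allows single vertices.
\<close>

definition vpt_rep :: "('a, 'b) pre_digraph \<Rightarrow> ('t, 'c) pre_digraph \<Rightarrow> ('a \<Rightarrow> 't list) \<Rightarrow> bool" where
  "vpt_rep G T P \<longleftrightarrow>
     undirected_tree T \<and>
     (\<forall>v \<in> verts G. vpath (P v) T) \<and>
     (\<forall>u \<in> verts G. \<forall>v \<in> verts G. u \<noteq> v \<longrightarrow>
        ((u, v) \<in> arcs_ends G \<longleftrightarrow> set (P u) \<inter> set (P v) \<noteq> {}))"

text \<open>
  Host trees are finite and simple, so up to isomorphism their vertices are natural numbers and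
  their arcs are pairs of vertices.
\<close>

definition VPT :: "('a, 'b) pre_digraph \<Rightarrow> bool" where
  "VPT G \<longleftrightarrow> (\<exists>(T :: nat pair_pre_digraph) P. vpt_rep G T P)"

text \<open>
  The class \<open>[h,2,1]\<close>. As every edge at \<open>x\<close> contributes exactly one arc leaving \<open>x\<close>, the
  \<^const>\<open>out_degree\<close> is the undirected degree.
\<close>

definition in_h21 :: "nat \<Rightarrow> ('a, 'b) pre_digraph \<Rightarrow> bool" where
  "in_h21 h G \<longleftrightarrow>
     (\<exists>(T :: nat pair_pre_digraph) P. vpt_rep G T P \<and> (\<forall>x \<in> verts T. out_degree T x \<le> h))"

text \<open>The graphs \<open>G - v\<close> are not required to be connected.\<close>

definition minimal_non_h21 :: "nat \<Rightarrow> ('a, 'b) pre_digraph \<Rightarrow> bool" where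
  "minimal_non_h21 h G \<longleftrightarrow>
     \<not> in_h21 h G \<and> (\<forall>v \<in> verts G. in_h21 h (pre_digraph.del_vert G v))"

definition stable_set :: "('a, 'b) pre_digraph \<Rightarrow> 'a set \<Rightarrow> bool" where
  "stable_set G S \<longleftrightarrow> S \<subseteq> verts G \<and> (\<forall>u \<in> S. \<forall>v \<in> S. (u, v) \<notin> arcs_ends G)"

definition clique :: "('a, 'b) pre_digraph \<Rightarrow> 'a set \<Rightarrow> bool" where
  "clique G K \<longleftrightarrow> K \<subseteq> verts G \<and> (\<forall>u \<in> K. \<forall>v \<in> K. u \<noteq> v \<longrightarrow> (u, v) \<in> arcs_ends G)"

definition split_partition :: "('a, 'b) pre_digraph \<Rightarrow> 'a set \<Rightarrow> 'a set \<Rightarrow> bool" where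
  "split_partition G S K \<longleftrightarrow>
     stable_set G S \<and> clique G K \<and> S \<union> K = verts G \<and> S \<inter> K = {}"

definition split_graph :: "('a, 'b) pre_digraph \<Rightarrow> bool" where
  "split_graph G \<longleftrightarrow> (\<exists>S K. split_partition G S K)"

definition dominated_stable_vertex :: "('a, 'b) pre_digraph \<Rightarrow> 'a set \<Rightarrow> 'a \<Rightarrow> bool" where
  "dominated_stable_vertex G S s \<longleftrightarrow>
     s \<in> S \<and> (\<exists>s' \<in> S. s' \<noteq> s \<and> neighbors G s \<subseteq> neighbors G s')"

end

theory Submission
  imports Defs
begin

text \<open>
  For a clique \<open>C\<close>, say that two vertices outside \<open>C\<close> cross if their neighbourhoods in \<open>C\<close> meet and are
  incomparable. In a representation of degree at most \<open>h\<close>, the paths of \<open>C\<close> share a node \<open>q\<close>, and colouring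
  the other vertices by the branch at \<open>q\<close> that contains their path separates crossing vertices.
  Conversely, if \<open>q\<close> has degree greater than \<open>h\<close> and the vertices missing \<open>q\<close> have such an
  \<open>h\<close>-colouring, then, after contracting edges at \<open>q\<close>, the branches at \<open>q\<close> can be coloured so that no path
  through \<open>q\<close> enters two branches of the same colour. Two branches of the same colour are hung
  below a new node of degree 3, and repeating this brings the degree of \<open>q\<close> down to \<open>h\<close>.

  So a minimal non-\<open>[h,2,1]\<close> graph has a clique \<open>C\<close> of all vertices through some node \<open>q\<close> without an
  \<open>h\<close>-colouring, whereas deleting any vertex makes one possible. If \<open>N(u) \<inter> C \<subseteq> N(v) \<inter> C\<close> for some
  \<open>u \<noteq> v\<close> outside \<open>C\<close>, then a colouring without \<open>u\<close> can be changed into one with \<open>u\<close>, so no such pair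
  exists. Adjacent vertices outside \<open>C\<close> have comparable neighbourhoods in \<open>C\<close>, hence the complement of
  \<open>C\<close> is stable; and every split partition turns out to have \<open>C\<close> as its clique.
\<close>

section \<open>Rooted trees and their paths\<close>

text \<open>The second argument is the upper node. Since \<open>p\<close> fixes the root of a
  \<open>rooted_tree\<close>, iterating past the root stays there.\<close>

definition ancestor :: "('t \<Rightarrow> 't) \<Rightarrow> 't \<Rightarrow> 't \<Rightarrow> bool" where
  "ancestor p x y \<longleftrightarrow> (\<exists>n. y = (p ^^ n) x)"

text \<open>The root is excluded because \<open>p q = q\<close> would make it its own child.\<close>

definition children :: "'t set \<Rightarrow> 't \<Rightarrow> ('t \<Rightarrow> 't) \<Rightarrow> 't \<Rightarrow> 't set" where
  "children N q p y = {x \<in> N. x \<noteq> q \<and> p x = y}"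

text \<open>These are the vertex sets of paths of the tree: a path climbs from one end to its top
  \<open>t\<close> and descends to the other end, hence two children at \<open>t\<close> and one
  elsewhere. Adjacency depends only on these sets, so the order along the path is dropped until
  \<open>vpath_of_path\<close> recovers it.\<close>

definition path_with_top :: "'t set \<Rightarrow> 't \<Rightarrow> ('t \<Rightarrow> 't) \<Rightarrow> 't set \<Rightarrow> 't \<Rightarrow> bool" where
  "path_with_top N q p X t \<longleftrightarrow>
     X \<subseteq> N \<and> t \<in> X \<and> (\<forall>x \<in> X - {t}. x \<noteq> q \<and> p x \<in> X) \<and>
     (\<forall>y \<in> X. card (children N q p y \<inter> X) \<le> (if y = t then 2 else 1))"

text \<open>The function \<open>d\<close> is any rank that decreases towards the root, not necessarily the depth.\<close>

locale rooted_tree =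
  fixes N :: "'t set" and q :: 't and p :: "'t \<Rightarrow> 't" and d :: "'t \<Rightarrow> nat"
  assumes finite_nodes: "finite N"
    and root_in: "q \<in> N"
    and parent_root: "p q = q"
    and parent_in: "x \<in> N \<Longrightarrow> x \<noteq> q \<Longrightarrow> p x \<in> N"
    and rank_parent: "x \<in> N \<Longrightarrow> x \<noteq> q \<Longrightarrow> d (p x) < d x"

lemma ancestor_refl [simp]: "ancestor p x x"
  unfolding ancestor_def by (rule exI[of _ 0]) simp

lemma ancestor_trans: "ancestor p x y \<Longrightarrow> ancestor p y z \<Longrightarrow> ancestor p x z"
  unfolding ancestor_def
proof (elim exE)
  fix m n assume "y = (p ^^ m) x" "z = (p ^^ n) y"
  then have "z = (p ^^ (n + m)) x" by (simp add: funpow_add)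
  then show "\<exists>n. z = (p ^^ n) x" ..
qed

lemma ancestor_parent: "ancestor p x (p x)"
  unfolding ancestor_def by (rule exI[of _ 1]) simp

lemma ancestor_cases: "ancestor p x y \<Longrightarrow> x = y \<or> ancestor p (p x) y"
  unfolding ancestor_def
proof (elim exE)
  fix n assume "y = (p ^^ n) x"
  then show "x = y \<or> (\<exists>n. y = (p ^^ n) (p x))"
    by (cases n) (auto simp: funpow_swap1)
qed

lemma ancestors_comparable:
  assumes "ancestor p x y" "ancestor p x z"
  shows "ancestor p y z \<or> ancestor p z y"
proof -
  have *: "ancestor p ((p ^^ m) x) ((p ^^ n) x)" if "m \<le> n" for m n
  proof -
    have "(p ^^ n) x = (p ^^ (n - m)) ((p ^^ m) x)"
      using that funpow_add[of "n - m" m p] by simp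
    then show ?thesis unfolding ancestor_def by blast
  qed
  obtain m n where "y = (p ^^ m) x" "z = (p ^^ n) x"
    using assms unfolding ancestor_def by blast
  then show ?thesis using *[of m n] *[of n m] by (cases "m \<le> n") auto
qed

context rooted_tree
begin

lemma finite_children: "finite (children N q p y)"
  using finite_nodes by (simp add: children_def)

lemma parent_in': "x \<in> N \<Longrightarrow> p x \<in> N"
  using parent_in parent_root root_in by (cases "x = q") auto

lemma ancestor_in: "x \<in> N \<Longrightarrow> ancestor p x y \<Longrightarrow> y \<in> N"
proof -
  have "x \<in> N \<Longrightarrow> (p ^^ n) x \<in> N" for n
    by (induction n) (auto intro: parent_in')
  then show "x \<in> N \<Longrightarrow> ancestor p x y \<Longrightarrow> y \<in> N"
    by (auto simp: ancestor_def)
qed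

lemma ancestor_rank: "ancestor p x y \<Longrightarrow> x \<in> N \<Longrightarrow> x = y \<or> d y < d x"
proof -
  have "x \<in> N \<Longrightarrow> (p ^^ n) x = x \<or> d ((p ^^ n) x) < d x" for n
  proof (induction n)
    case (Suc n)
    have "(p ^^ n) x \<in> N"
      using Suc.prems ancestor_in[of x] by (auto simp: ancestor_def)
    then show ?case
      using Suc rank_parent[of "(p ^^ n) x"] parent_root by (cases "(p ^^ n) x = q") auto
  qed simp
  then show "ancestor p x y \<Longrightarrow> x \<in> N \<Longrightarrow> x = y \<or> d y < d x"
    unfolding ancestor_def by metis
qed

lemma ancestor_antisym: "x \<in> N \<Longrightarrow> ancestor p x y \<Longrightarrow> ancestor p y x \<Longrightarrow> x = y"
  using ancestor_rank[of x y] ancestor_rank[of y x] ancestor_in[of x y] by auto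

lemma ancestor_root: "x \<in> N \<Longrightarrow> ancestor p x q"
proof (induction "d x" arbitrary: x rule: less_induct)
  case less
  show ?case
    using less rank_parent[of x] parent_in[of x] ancestor_parent[of p x] ancestor_trans[of p x "p x" q]
    by (cases "x = q") auto
qed

lemma ancestor_of_root: "ancestor p q x \<Longrightarrow> x = q"
  using ancestor_antisym[of q x] ancestor_root[of x] ancestor_in[of q x] root_in by simp

lemma path_ancestor_top:
  assumes "path_with_top N q p X t"
  shows "y \<in> X \<Longrightarrow> ancestor p y t"
proof (induction "d y" arbitrary: y rule: less_induct)
  case less
  have "y = t \<or> (y \<in> N \<and> y \<noteq> q \<and> p y \<in> X)"
    using assms less.prems by (auto simp: path_with_top_def)
  then show ?case
    using less rank_parent[of y] ancestor_parent ancestor_trans by (metis ancestor_refl)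
qed

text \<open>Climbing by parents leaves \<open>X\<close> only above \<open>t\<close>, where all ranks
  are smaller than \<open>d t\<close>.\<close>

lemma path_upward:
  assumes X: "path_with_top N q p X t"
  shows "y \<in> X \<Longrightarrow> ancestor p y z \<Longrightarrow> d t \<le> d z \<Longrightarrow> z \<in> X"
proof (induction "d y" arbitrary: y rule: less_induct)
  case less
  have yN: "y \<in> N" using X less.prems by (auto simp: path_with_top_def)
  show ?case
  proof (cases "y = z")
    case False
    then have az: "ancestor p (p y) z" "d z < d y"
      using ancestor_cases less.prems ancestor_rank yN by metis+
    have "y \<noteq> t" using az less.prems by auto
    then have "y \<noteq> q \<and> p y \<in> X"
      using X less.prems by (auto simp: path_with_top_def)
    then show ?thesis using less az yN rank_parent by blast
  qed (use less in simp)
qed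

text \<open>The top \<open>s\<close> is an ancestor of the common node \<open>y\<close>, and its
  rank is large enough for the climb from \<open>y\<close> inside \<open>X\<close> to reach it.
  Adjacency to the root clique and the Helly property both rest on this.\<close>

lemma path_inter_top:
  assumes "path_with_top N q p X t" "path_with_top N q p Y s"
    and "y \<in> X \<inter> Y" and "d t \<le> d s"
  shows "s \<in> X"
  using assms path_upward path_ancestor_top by blast

lemma path_top_root:
  assumes "path_with_top N q p X t" "q \<in> X" shows "t = q"
  using assms by (auto simp: path_with_top_def)

lemma path_children_unique:
  assumes "path_with_top N q p X t" "y \<noteq> t" "a \<in> X" "b \<in> X" "a \<noteq> q" "b \<noteq> q" "p a = y" "p b = y" "y \<in> X"
  shows "a = b"
proof -
  have "card (children N q p y \<inter> X) \<le> 1"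
    using assms by (force simp: path_with_top_def)
  moreover have "{a, b} \<subseteq> children N q p y \<inter> X"
    using assms by (auto simp: children_def path_with_top_def)
  ultimately show ?thesis
    using card_mono[of "children N q p y \<inter> X" "{a,b}"] finite_children
    by (cases "a = b") auto
qed

lemma path_top_children:
  assumes "path_with_top N q p X t" "a \<in> X" "b \<in> X" "c \<in> X" "a \<noteq> q" "b \<noteq> q" "c \<noteq> q"
    "p a = t" "p b = t" "p c = t"
  shows "a = b \<or> a = c \<or> b = c"
proof (rule ccontr)
  assume contr: "\<not> ?thesis"
  have "card (children N q p t \<inter> X) \<le> 2"
    using assms by (force simp: path_with_top_def)
  moreover have "{a, b, c} \<subseteq> children N q p t \<inter> X"
    using assms by (auto simp: children_def path_with_top_def)
  ultimately show False
    using card_mono[of "children N q p t \<inter> X" "{a,b,c}"] finite_children contr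
    by auto
qed

section \<open>Branches at the root\<close>

definition branch :: "'t \<Rightarrow> 't" where
  "branch x = (SOME r. r \<in> children N q p q \<and> ancestor p x r)"

lemma ex_branch: "x \<in> N \<Longrightarrow> x \<noteq> q \<Longrightarrow> \<exists>r. r \<in> children N q p q \<and> ancestor p x r"
proof (induction "d x" arbitrary: x rule: less_induct)
  case less
  show ?case
  proof (cases "p x = q")
    case True
    then show ?thesis using less.prems by (auto simp: children_def intro: exI[of _ x])
  next
    case False
    then show ?thesis
      using less.hyps[of "p x"] less.prems rank_parent parent_in ancestor_parent ancestor_trans by metis
  qed
qed

lemma branch_props:
  assumes "x \<in> N" "x \<noteq> q"
  shows "branch x \<in> children N q p q" "ancestor p x (branch x)"
  using someI_ex[OF ex_branch[OF assms]] unfolding branch_def by auto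

text \<open>Ancestors of \<open>x\<close> are comparable, and a child of the root is never below
  another one, because the next step up from it is the root itself.\<close>

lemma branch_unique:
  assumes x: "x \<in> N" "x \<noteq> q" and r: "r \<in> children N q p q" "ancestor p x r"
  shows "branch x = r"
proof -
  have *: "a = b" if "a \<in> children N q p q" "b \<in> children N q p q" "ancestor p a b" for a b
  proof (rule ccontr)
    assume "a \<noteq> b"
    then have "ancestor p q b" using that ancestor_cases[of p a b] by (auto simp: children_def)
    then show False using ancestor_of_root that(2) by (auto simp: children_def)
  qed
  from ancestors_comparable[OF r(2) branch_props(2)[OF x]]
  show ?thesis using *[OF r(1) branch_props(1)[OF x]] *[OF branch_props(1)[OF x] r(1)] by auto
qed

lemma branch_parent:
  assumes "x \<in> N" "x \<noteq> q" "p x \<noteq> q"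
  shows "branch (p x) = branch x"
proof -
  have "p x \<in> N" using assms parent_in by blast
  from branch_props[OF this assms(3)] have "branch x = branch (p x)"
    using ancestor_trans[OF ancestor_parent] by (intro branch_unique assms)
  then show ?thesis by simp
qed

text \<open>A path with the root on top descends into each branch as a single chain. The induction
  moves \<open>a\<close> upwards: a child of the root is above its whole branch, and otherwise
  \<open>p a\<close> is already comparable with \<open>b\<close>.\<close>

lemma root_path_chain:
  assumes X: "path_with_top N q p X q" and b: "b \<in> X" "b \<noteq> q"
  shows "a \<in> X \<Longrightarrow> a \<noteq> q \<Longrightarrow> branch a = branch b \<Longrightarrow> ancestor p a b \<or> ancestor p b a"
proof (induction "d a" arbitrary: a rule: less_induct)
  case less
  have N: "a \<in> N" "b \<in> N" using X b less.prems by (auto simp: path_with_top_def)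
  show ?case
  proof (cases "p a = q")
    case True
    then have "branch a = a"
      using N less.prems by (intro branch_unique) (auto simp: children_def)
    then show ?thesis using branch_props[OF N(2) b(2)] less.prems by auto
  next
    case False
    have paX: "p a \<in> X" using X less.prems by (auto simp: path_with_top_def)
    from less.hyps[OF rank_parent[OF N(1) less.prems(2)] paX False]
    have "ancestor p (p a) b \<or> ancestor p b (p a)"
      using branch_parent[OF N(1) less.prems(2) False] less.prems by simp
    then show ?thesis
    proof
      assume "ancestor p (p a) b"
      then show ?thesis using ancestor_parent ancestor_trans by metis
    next
      assume "ancestor p b (p a)"
      \<comment> \<open>As \<open>p a\<close> is not the top, \<open>a\<close> is its only child on
        the path, so everything of \<open>X\<close> strictly below \<open>p a\<close> is below
        \<open>a\<close>.\<close>
      have *: "c \<in> X \<Longrightarrow> ancestor p c (p a) \<Longrightarrow> c \<noteq> p a \<Longrightarrow> ancestor p c a" for c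
      proof (induction "d c" arbitrary: c rule: less_induct)
        case (less c)
        have cN: "c \<in> N" using X less.prems by (auto simp: path_with_top_def)
        have cq: "c \<noteq> q" using less.prems ancestor_of_root by metis
        then have pcX: "p c \<in> X" using X less.prems by (auto simp: path_with_top_def)
        have anc: "ancestor p (p c) (p a)" using less.prems ancestor_cases by metis
        show ?case
        proof (cases "p c = p a")
          case True
          then have "c = a"
            using path_children_unique[OF X False less.prems(1) \<open>a \<in> X\<close> cq \<open>a \<noteq> q\<close> True refl paX] by simp
          then show ?thesis by simp
        next
          case False
          then have "ancestor p (p c) a"
            using less.hyps[OF rank_parent[OF cN cq] pcX anc] by simp
          then show ?thesis using ancestor_parent ancestor_trans by metis
        qed
      qed
      show ?thesis
        using *[OF b(1) \<open>ancestor p b (p a)\<close>] ancestor_parent by metis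
    qed
  qed
qed

end

section \<open>Paths as vertex lists and as vertex sets\<close>

definition tree_edges :: "'t set \<Rightarrow> 't \<Rightarrow> ('t \<Rightarrow> 't) \<Rightarrow> ('t \<times> 't) set" where
  "tree_edges N q p = {(x, y). x \<in> N \<and> y \<in> N \<and> (x \<noteq> q \<and> y = p x \<or> y \<noteq> q \<and> x = p y)}"

lemma nth_in_vwalk_arcs: "Suc i < length l \<Longrightarrow> (l ! i, l ! Suc i) \<in> set (vwalk_arcs l)"
proof (induction l arbitrary: i rule: vwalk_arcs.induct)
  case (3 x y xs)
  then show ?case by (cases i) auto
qed auto

lemma (in wf_digraph) vwalk_imp_awalk:
  assumes "vwalk w G"
  shows "\<exists>es. awalk (hd w) es (last w) \<and> awalk_verts (hd w) es = w"
  using assms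
proof (induction w rule: vwalk_induct)
  case (Base u)
  then show ?case by (auto intro!: exI[of _ "[]"] simp: awalk_Nil_iff)
next
  case (Cons u v ws)
  then obtain es where es: "awalk v es (last (v # ws))" "awalk_verts v es = v # ws" by auto
  from Cons obtain e where "e \<in> arcs G" "tail G e = u" "head G e = v" by auto
  then show ?case using es by (auto intro!: exI[of _ "e # es"] simp: awalk_Cons_iff)
qed

text \<open>Cycles are lists of arcs, so \<open>w\<close> is lifted to an arc walk and the closing
  arc from \<open>last w\<close> to \<open>hd w\<close> is put in front.\<close>

lemma (in graph) cycle_of_vpath:
  assumes w: "vpath w G" and "3 \<le> length w" and "(last w, hd w) \<in> arcs_ends G"
  shows "\<exists>c. cycle c \<and> 3 \<le> length c"
proof -
  obtain es where es: "awalk (hd w) es (last w)" "awalk_verts (hd w) es = w"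
    using vwalk_imp_awalk w by blast
  obtain e where e: "e \<in> arcs G" "tail G e = last w" "head G e = hd w" using assms(3) by auto
  have "awalk (last w) (e # es) (last w)" using es e by (auto simp: awalk_Cons_iff)
  moreover have "distinct (tl (awalk_verts (last w) (e # es)))"
    using es e w by auto
  moreover have "length (e # es) = length w"
    using es length_awalk_verts[of "hd w" es] by simp
  ultimately show ?thesis using assms(2) unfolding cycle_def by (intro exI[of _ "e # es"]) auto
qed

context rooted_tree
begin

text \<open>Induction on the list, adding \<open>x\<close> before the head \<open>y\<close>. If
  \<open>x\<close> is below \<open>y\<close>, the top stays; if \<open>x\<close> is above
  \<open>y\<close>, then \<open>y\<close> was the top and \<open>x\<close> becomes the new one. The
  second conjunct strengthens the induction: the head is an end of the path and still has room for
  one more child.\<close>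

lemma path_of_vpath:
  assumes "l \<noteq> []" "distinct l" "set l \<subseteq> N" "set (vwalk_arcs l) \<subseteq> tree_edges N q p"
  shows "\<exists>t. path_with_top N q p (set l) t \<and>
    card (children N q p (hd l) \<inter> set l) \<le> (if hd l = t then 1 else 0)"
  using assms
proof (induction l rule: vwalk_arcs.induct)
  case (2 x)
  have "children N q p x \<inter> {x} = {}"
    using rank_parent[of x] by (auto simp: children_def)
  then show ?case using 2 by (intro exI[of _ x]) (auto simp: path_with_top_def)
next
  case (3 x y l)
  define S where "S = set (y # l)"
  obtain t where t: "path_with_top N q p S t"
      "card (children N q p y \<inter> S) \<le> (if y = t then 1 else 0)"
    using 3 by (auto simp: S_def)
  have xy: "x \<in> N" "y \<in> N" "y \<in> S" "x \<notin> S" "S \<subseteq> N" "t \<in> S" "x \<noteq> t"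
    and sx: "set (x # y # l) = insert x S"
    using 3 t by (auto simp: S_def path_with_top_def)
  have par: "s \<noteq> q" "p s \<in> S" if "s \<in> S" "s \<noteq> t" for s
    using t that by (auto simp: path_with_top_def)
  have cd: "card (children N q p z \<inter> S) \<le> (if z = t then 2 else 1)" if "z \<in> S" for z
    using t that by (auto simp: path_with_top_def)
  have top: "d t \<le> d s" if "s \<in> S" for s
    using path_ancestor_top[OF t(1) that] ancestor_rank xy that by fastforce
  have nself: "x \<notin> children N q p x"
    using rank_parent[of x] by (auto simp: children_def)
  have "x \<noteq> q \<and> y = p x \<or> y \<noteq> q \<and> x = p y"
    using 3 by (auto simp: tree_edges_def)
  then show ?case
  proof
    assume up: "x \<noteq> q \<and> y = p x"
    \<comment> \<open>A child \<open>c\<close> of \<open>x\<close> in \<open>S\<close> has its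
      parent outside \<open>S\<close>, so it is the top; but its rank exceeds that of
      \<open>x\<close>, hence that of \<open>y\<close>.\<close>
    have "c \<notin> S" if "c \<in> children N q p x" for c
    proof
      assume "c \<in> S"
      have c: "c \<in> N" "c \<noteq> q" "p c = x" using that by (auto simp: children_def)
      then have "c = t" using par \<open>c \<in> S\<close> xy by auto
      then show False using c rank_parent[of c] rank_parent[of x] top[OF xy(3)] up xy by simp
    qed
    then have chx: "children N q p x \<inter> insert x S = {}" using nself by auto
    have "card (children N q p z \<inter> insert x S) \<le> (if z = t then 2 else 1)" if z: "z \<in> insert x S" for z
    proof -
      consider "z = x" | "z = y" | "z \<in> S" "z \<noteq> y" using z by auto
      then show ?thesis
      proof cases
        case 1 then show ?thesis using chx by simp
      next
        case 2
        have "card (children N q p y \<inter> insert x S) \<le> card (insert x (children N q p y \<inter> S))"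
          using finite_children by (intro card_mono) auto
        also have "\<dots> \<le> Suc (card (children N q p y \<inter> S))" by (rule card_insert_le_m1) auto
        finally show ?thesis using t 2 by auto
      next
        case 3
        then have "children N q p z \<inter> insert x S = children N q p z \<inter> S"
          using up by (auto simp: children_def)
        then show ?thesis using cd 3 by auto
      qed
    qed
    then have "path_with_top N q p (insert x S) t"
      using par xy up unfolding path_with_top_def by auto
    then show ?thesis unfolding sx using chx xy by (intro exI[of _ t]) simp
  next
    assume down: "y \<noteq> q \<and> x = p y"
    have yt: "y = t" using par[OF xy(3)] xy down by auto
    have "children N q p x \<inter> insert x S \<subseteq> {y}"
      using par xy yt nself by (auto simp: children_def)
    then have chx: "card (children N q p x \<inter> insert x S) \<le> 1"
      using card_mono[of "{y}"] by force
    have "card (children N q p z \<inter> insert x S) \<le> 1" if z: "z \<in> S" for z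
    proof -
      have "d y \<le> d z" using top z yt by simp
      then have "x \<notin> children N q p z"
        using rank_parent[of x] rank_parent[of y] xy down by (auto simp: children_def)
      then have "children N q p z \<inter> insert x S = children N q p z \<inter> S" by auto
      then show ?thesis using cd[OF z] t yt by (cases "z = t") auto
    qed
    then have "path_with_top N q p (insert x S) x"
      using chx par xy yt down unfolding path_with_top_def by auto
    then show ?thesis unfolding sx using chx by (intro exI[of _ x]) simp
  qed
qed simp

text \<open>A node \<open>x\<close> of maximal rank is a leaf of the path. It is removed, the rest
  is listed by induction, and \<open>x\<close> is attached at the end of the list where its parent
  stands.\<close>

lemma vpath_of_path:
  assumes "path_with_top N q p X t"
  shows "\<exists>l. distinct l \<and> set l = X \<and> set (vwalk_arcs l) \<subseteq> tree_edges N q p"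
  using assms
proof (induction "card X" arbitrary: X rule: less_induct)
  case less
  note X = less.prems
  have XN: "X \<subseteq> N" and tX: "t \<in> X" and fin: "finite X"
    using X finite_nodes by (auto simp: path_with_top_def dest: finite_subset)
  have par: "s \<noteq> q" "p s \<in> X" if "s \<in> X" "s \<noteq> t" for s
    using X that by (auto simp: path_with_top_def)
  have cd: "card (children N q p z \<inter> X) \<le> (if z = t then 2 else 1)" if "z \<in> X" for z
    using X that by (auto simp: path_with_top_def)
  show ?case
  proof (cases "X = {t}")
    case True
    then show ?thesis by (intro exI[of _ "[t]"]) auto
  next
    case False
    have "Max (d ` X) \<in> d ` X" using fin tX by (intro Max_in) auto
    then obtain x where "x \<in> X" "Max (d ` X) = d x" by blast
    then have x: "x \<in> X" "\<And>y. y \<in> X \<Longrightarrow> d y \<le> d x"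
      using fin Max_ge[of "d ` X"] by auto
    obtain y0 where "y0 \<in> X" "y0 \<noteq> t" using False tX by auto
    then have "d t < d y0" using path_ancestor_top[OF X] ancestor_rank XN by blast
    then have xt: "x \<noteq> t" using x(2)[OF \<open>y0 \<in> X\<close>] by auto
    have pne: "p s \<noteq> x" if "s \<in> X" "s \<noteq> t" for s
      using rank_parent[of s] par[OF that] x(2)[OF that(1)] XN that by auto
    have "card (children N q p z \<inter> (X - {x})) \<le> card (children N q p z \<inter> X)" for z
      using finite_children by (intro card_mono) auto
    then have "card (children N q p z \<inter> (X - {x})) \<le> (if z = t then 2 else 1)" if "z \<in> X" for z
      using cd[OF that] le_trans by blast
    then have "path_with_top N q p (X - {x}) t"
      using XN tX xt par pne unfolding path_with_top_def by auto
    moreover have "card (X - {x}) < card X" using x fin by (intro psubset_card_mono) auto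
    ultimately obtain l where l: "distinct l" "set l = X - {x}" "set (vwalk_arcs l) \<subseteq> tree_edges N q p"
      using less.hyps by blast
    define y where "y = p x"
    have y: "y \<in> X" "x \<noteq> q" "y \<noteq> x" using par[OF x(1) xt] pne[OF x(1) xt] by (auto simp: y_def)
    have xch: "x \<in> children N q p y" using x y XN by (auto simp: children_def y_def)
    have lne: "l \<noteq> []" using l y by auto
    \<comment> \<open>An inner \<open>y\<close> has two neighbours in \<open>l\<close> besides
      \<open>x\<close>. At the top all three are children, since the parent of \<open>t\<close> is
      not in \<open>X\<close>; elsewhere at least one of the two is a second child. Both exceed the
      bounds.\<close>
    have "y = hd l \<or> y = last l"
    proof (rule ccontr)
      assume ends: "\<not> ?thesis"
      obtain i where i: "i < length l" "l ! i = y" using l y by (metis Diff_iff in_set_conv_nth singletonD)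
      have "i \<noteq> 0" using i ends lne by (metis hd_conv_nth)
      then obtain j where j: "i = Suc j" by (cases i) auto
      have si: "Suc i < length l"
        using i ends lne by (metis Suc_lessI diff_Suc_1 last_conv_nth)
      let ?u = "l ! j" and ?w = "l ! Suc i"
      have uw: "?u \<noteq> ?w" using l(1) j si i by (simp add: nth_eq_iff_index_eq)
      have uwX: "?u \<in> X" "?u \<noteq> x" "?w \<in> X" "?w \<noteq> x"
        using l(2) si i j nth_mem[of j l] nth_mem[of "Suc i" l] by auto
      have "(?u, y) \<in> tree_edges N q p" "(y, ?w) \<in> tree_edges N q p"
        using nth_in_vwalk_arcs[of j l] nth_in_vwalk_arcs[of i l] si i j l(3) by auto
      then have adj: "?u \<in> children N q p y \<or> y \<noteq> q \<and> ?u = p y" "?w \<in> children N q p y \<or> y \<noteq> q \<and> ?w = p y"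
        by (auto simp: tree_edges_def children_def)
      show False
      proof (cases "y = t")
        case True
        have "d t \<le> d s" if "s \<in> X" for s
          using path_ancestor_top[OF X that] ancestor_rank XN that by fastforce
        then have "s \<noteq> p t" if "s \<in> X" "t \<noteq> q" for s
          using rank_parent[of t] that XN tX leD by blast
        then have "{x, ?u, ?w} \<subseteq> children N q p t \<inter> X"
          using adj True uwX xch x by auto
        then have "card {x, ?u, ?w} \<le> 2"
          using cd[OF tX] card_mono[of "children N q p t \<inter> X" "{x, ?u, ?w}"] finite_children by force
        then show False using uw uwX by auto
      next
        case False
        have "s = x" if "s \<in> children N q p y" "s \<in> X" for s
          using path_children_unique[OF X False that(2) x(1), of] that xch y
          by (auto simp: children_def)
        then show False using adj uw uwX by auto
      qed
    qed
    moreover have E: "(x, y) \<in> tree_edges N q p" "(y, x) \<in> tree_edges N q p"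
      using x y XN by (auto simp: tree_edges_def y_def)
    ultimately show ?thesis
    proof (elim disjE)
      assume "y = hd l"
      then show ?thesis using l x E lne by (intro exI[of _ "x # l"]) auto
    next
      assume "y = last l"
      then show ?thesis using l x E lne by (intro exI[of _ "l @ [x]"]) (auto simp: set_vwalk_arcs_snoc)
    qed
  qed
qed

end

section \<open>Rooted representations\<close>

definition node_degree :: "'t set \<Rightarrow> 't \<Rightarrow> ('t \<Rightarrow> 't) \<Rightarrow> 't \<Rightarrow> nat" where
  "node_degree N q p x = card (children N q p x) + (if x = q then 0 else 1)"

text \<open>Connectedness is defined through \<open>mk_symmetric\<close>, which does not change the
  adjacency of a digraph that is already symmetric.\<close>

lemma mk_symmetric_graph:
  assumes "graph T"
  shows "parcs (mk_symmetric T) = arcs_ends T" "pverts (mk_symmetric T) = verts T"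
proof -
  interpret graph T by fact
  have "(head T e, tail T e) \<in> arcs_ends T" if "e \<in> arcs T" for e
    using sym_arcs that by (auto simp: symmetric_def arcs_ends_conv elim!: symE)
  then show "parcs (mk_symmetric T) = arcs_ends T"
    by (auto simp: mk_symmetric_def arcs_ends_conv)
  show "pverts (mk_symmetric T) = verts T" by (simp add: mk_symmetric_def)
qed

lemma tree_edges_sym: "(x, y) \<in> tree_edges N q p \<longleftrightarrow> (y, x) \<in> tree_edges N q p"
  by (auto simp: tree_edges_def)

section \<open>The rooted tree as an undirected tree\<close>

context rooted_tree
begin

definition tree_graph :: "'t pair_pre_digraph" where
  "tree_graph = \<lparr>pverts = N, parcs = tree_edges N q p\<rparr>"

lemma tree_edges_ne: "(x, y) \<in> tree_edges N q p \<Longrightarrow> x \<noteq> y"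
proof -
  assume "(x, y) \<in> tree_edges N q p"
  then have "d x \<noteq> d y" using rank_parent[of x] rank_parent[of y] by (auto simp: tree_edges_def)
  then show "x \<noteq> y" by auto
qed

lemma tree_graph_graph: "pair_graph tree_graph"
proof
  show "finite (parcs tree_graph)"
    by (rule finite_subset[of _ "N \<times> N"]) (auto simp: tree_graph_def tree_edges_def finite_nodes)
  show "symmetric tree_graph"
    by (auto simp: tree_graph_def symmetric_def intro!: symI intro: tree_edges_sym[THEN iffD1])
  show "e \<in> parcs tree_graph \<Longrightarrow> fst e \<noteq> snd e" for e
    using tree_edges_ne[of "fst e" "snd e"] by (simp add: tree_graph_def)
qed (auto simp: tree_graph_def tree_edges_def finite_nodes)

lemma tree_graph_reachable:
  assumes "x \<in> N" "y \<in> N" shows "x \<rightarrow>\<^sup>*\<^bsub>with_proj tree_graph\<^esub> y"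
proof -
  interpret pair_graph tree_graph by (rule tree_graph_graph)
  have "reachable tree_graph x q \<and> reachable tree_graph q x" if "x \<in> N" for x
    using that
  proof (induction "d x" arbitrary: x rule: less_induct)
    case less
    show ?case
    proof (cases "x = q")
      case True
      have "q \<in> pverts tree_graph" using root_in by (simp add: tree_graph_def)
      then show ?thesis using True reachable_refl by simp
    next
      case False
      then have "(x, p x) \<in> parcs tree_graph" "(p x, x) \<in> parcs tree_graph"
        using less.prems parent_in by (auto simp: tree_graph_def tree_edges_def)
      then show ?thesis
        using less.hyps[OF rank_parent[OF less.prems False] parent_in[OF less.prems False]]
        by (meson adj_reachable_trans reachable_adj_trans)
    qed
  qed
  then show ?thesis using assms reachable_trans by blast
qed

lemma edge_below: "(x, y) \<in> tree_edges N q p \<Longrightarrow> d y \<le> d x \<Longrightarrow> y = p x"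
  using rank_parent by (force simp: tree_edges_def)

text \<open>A node of maximal rank on a cycle has both of its neighbours equal to its parent.\<close>

lemma undirected_tree_tree_graph: "undirected_tree tree_graph"
proof -
  interpret pair_graph tree_graph by (rule tree_graph_graph)
  have "graph tree_graph" by (rule pair_graphD_graph)
  moreover have "Digraph_Component.connected tree_graph"
  proof -
    have "mk_symmetric tree_graph = tree_graph"
      using mk_symmetric_graph[OF pair_graphD_graph] by simp
    then show ?thesis unfolding connected_def strongly_connected_def
      using tree_graph_reachable root_in by (auto simp: tree_graph_def)
  qed
  moreover have False if c: "cycle c" and len: "length c \<ge> 3" for c
  proof -
    obtain u where u: "awalk u c u" "distinct (tl (awalk_verts u c))" "c \<noteq> []"
      using c unfolding cycle_def by blast
    define ys n where "ys = awalk_verts u c" and "n = length c"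
    have ly: "length ys = Suc n" unfolding ys_def n_def by (rule length_awalk_verts)
    have y0: "ys ! 0 = u" "ys ! n = u"
      using u(1) ly unfolding ys_def n_def
      by (metis awalkE awalk_verts_non_Nil hd_conv_nth, metis awalkE awalk_verts_non_Nil last_conv_nth diff_Suc_1)
    have inj: "i = j" if "ys ! i = ys ! j" "0 < i" "i \<le> n" "0 < j" "j \<le> n" for i j
    proof -
      have "tl ys ! (i - 1) = tl ys ! (j - 1)" using that ly by (simp add: nth_tl)
      then have "i - 1 = j - 1"
        using u(2) that ly unfolding ys_def[symmetric] by (subst (asm) nth_eq_iff_index_eq) auto
      then show ?thesis using that by simp
    qed
    have "vwalk ys tree_graph" unfolding ys_def using u(1) by (rule awalk_imp_vwalk)
    then have E: "(ys ! i, ys ! Suc i) \<in> tree_edges N q p" if "i < n" for i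
      using nth_in_vwalk_arcs[of i ys] that ly by (auto simp: vwalk_def tree_graph_def)
    have "Max ((\<lambda>i. d (ys ! i)) ` {1..n}) \<in> (\<lambda>i. d (ys ! i)) ` {1..n}"
      using len n_def by (intro Max_in) auto
    then obtain m where m: "1 \<le> m" "m \<le> n" "Max ((\<lambda>i. d (ys ! i)) ` {1..n}) = d (ys ! m)" by auto
    then have mx: "d (ys ! i) \<le> d (ys ! m)" if "1 \<le> i" "i \<le> n" for i
      using Max_ge[of "(\<lambda>i. d (ys ! i)) ` {1..n}" "d (ys ! i)"] that by auto
    have mx0: "d (ys ! i) \<le> d (ys ! m)" if "i \<le> n" for i
      using mx[of i] mx[of n] y0 that len n_def by (cases "i = 0") auto
    \<comment> \<open>Positions \<open>0\<close> and \<open>n\<close> hold the same node, so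
      \<open>a\<close> and \<open>b\<close> are the cyclic neighbours of \<open>m\<close> within
      \<open>1..n\<close>; they differ because \<open>n\<close> is at least 3.\<close>
    define a b where "a = (if m = 1 then n else m - 1)" and "b = (if m = n then 1 else m + 1)"
    have ab: "1 \<le> a" "a \<le> n" "1 \<le> b" "b \<le> n" "a \<noteq> b"
      using m len n_def by (auto simp: a_def b_def)
    have "ys ! a = ys ! (m - 1)" using y0 by (auto simp: a_def)
    moreover have "(ys ! (m - 1), ys ! m) \<in> tree_edges N q p"
      using E[of "m - 1"] m by auto
    ultimately have "ys ! a = p (ys ! m)"
      using edge_below[of "ys ! m" "ys ! a"] tree_edges_sym mx[OF ab(1,2)] by metis
    moreover have "(ys ! m, ys ! b) \<in> tree_edges N q p"
      using E[of m] E[of 0] m y0 by (cases "m = n") (auto simp: b_def)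
    then have "ys ! b = p (ys ! m)"
      using edge_below[of "ys ! m" "ys ! b"] mx[OF ab(3,4)] by blast
    ultimately show False using inj[of a b] ab by auto
  qed
  ultimately show ?thesis unfolding undirected_tree_def by blast
qed

lemma card_tree_edges:
  assumes "x \<in> N"
  shows "card {y. (x, y) \<in> tree_edges N q p} = node_degree N q p x"
proof -
  have "{y. (x, y) \<in> tree_edges N q p} = children N q p x \<union> (if x = q then {} else {p x})"
    using assms parent_in by (auto simp: tree_edges_def children_def)
  moreover have "p x \<notin> children N q p x" if "x \<noteq> q"
    using rank_parent[of x] rank_parent[of "p x"] assms that by (auto simp: children_def)
  ultimately show ?thesis using finite_children unfolding node_degree_def by auto
qed

end

lemma (in graph) out_degree_neighbors: "out_degree G x = card {y. (x, y) \<in> arcs_ends G}"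
proof -
  have "inj_on (head G) (out_arcs G x)"
    using no_multi_arcs by (auto simp: inj_on_def out_arcs_def arc_to_ends_def)
  moreover have "head G ` out_arcs G x = {y. (x, y) \<in> arcs_ends G}"
    by (auto simp: out_arcs_def arcs_ends_conv image_iff)
  ultimately show ?thesis unfolding out_degree_def using card_image by metis
qed

text \<open>The rank is the distance from \<open>q\<close>, and a parent is any neighbour of smaller
  distance. An edge \<open>(a, b)\<close> of \<open>T\<close> outside \<open>tree_edges\<close>
  would close a cycle with the tree path from \<open>a\<close> to \<open>b\<close>, which has at
  least three nodes because its ends are not joined by a tree edge.\<close>

lemma ex_rooting:
  assumes T: "undirected_tree T" and q: "q \<in> verts T"
  shows "\<exists>p d. rooted_tree (verts T) q p d \<and> arcs_ends T = tree_edges (verts T) q p"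
proof -
  define E where "E = arcs_ends T"
  interpret T: graph T using T by (simp add: undirected_tree_def)
  have E: "(y, x) \<in> E" "x \<in> verts T" "y \<in> verts T" "x \<noteq> y" if "(x, y) \<in> E" for x y
    using that T.sym_arcs T.adj_not_same
    by (auto simp: E_def symmetric_def elim: symE dest: T.adj_in_verts)
  have reach: "(q, x) \<in> E\<^sup>*" if "x \<in> verts T" for x
  proof -
    have "reachable (mk_symmetric T) q x"
      using T q that mk_symmetric_graph[OF T.graph_axioms]
      by (auto simp: undirected_tree_def connected_def strongly_connected_def)
    then show ?thesis
      using mk_symmetric_graph[OF T.graph_axioms]
      by (auto simp: reachable_def E_def intro: rtrancl_on_rtranclI)
  qed
  define d where "d x = (LEAST n. (q, x) \<in> E ^^ n)" for x
  define p where "p x = (if x = q then q else SOME y. (y, x) \<in> E \<and> d y < d x)" for x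
  have p: "(p x, x) \<in> E" "d (p x) < d x" if xv: "x \<in> verts T" "x \<noteq> q" for x
  proof -
    obtain n where "(q, x) \<in> E ^^ n" using reach[OF xv(1)] rtrancl_imp_relpow by blast
    then have dx: "(q, x) \<in> E ^^ d x" unfolding d_def by (rule LeastI)
    then obtain m where m: "d x = Suc m" using xv by (cases "d x") auto
    then obtain y where y: "(q, y) \<in> E ^^ m" "(y, x) \<in> E" using dx by auto
    then have "d y < d x" using m Least_le[of "\<lambda>n. (q, y) \<in> E ^^ n" m] by (simp add: d_def)
    then have "\<exists>y. (y, x) \<in> E \<and> d y < d x" using y by blast
    from someI_ex[OF this] show "(p x, x) \<in> E" "d (p x) < d x" using xv by (auto simp: p_def)
  qed
  interpret R: rooted_tree "verts T" q p d
    using p q E(2) by unfold_locales (auto simp: p_def)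
  have sub: "tree_edges (verts T) q p \<subseteq> E"
    using p E(1) by (auto simp: tree_edges_def)
  have "E \<subseteq> tree_edges (verts T) q p"
  proof (intro subrelI)
    fix a b assume ab: "(a, b) \<in> E"
    show "(a, b) \<in> tree_edges (verts T) q p"
    proof (rule ccontr)
      assume nt: "(a, b) \<notin> tree_edges (verts T) q p"
      interpret H: pair_graph R.tree_graph by (rule R.tree_graph_graph)
      obtain w where w: "vpath w R.tree_graph" "hd w = a" "last w = b"
        using R.tree_graph_reachable[of a b] E(2,3)[OF ab] H.reachable_vpath_conv by blast
      have "vpath w T"
        using w(1) sub by (auto simp: vpath_def vwalk_def R.tree_graph_def E_def)
      moreover have "length w \<ge> 3"
      proof (cases w rule: vwalk_arcs.cases)
        case 1 then show ?thesis using w by (auto simp: vpath_def vwalk_def)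
      next
        case 2 then show ?thesis using w E(4)[OF ab] by auto
      next
        case (3 x y ws)
        then have "ws \<noteq> []" using w nt by (auto simp: vpath_def vwalk_def R.tree_graph_def)
        then show ?thesis using 3 by (cases ws) auto
      qed
      ultimately show False
        using T.cycle_of_vpath[of w] w E(1)[OF ab] T unfolding undirected_tree_def E_def by blast
    qed
  qed
  then show ?thesis using sub R.rooted_tree_axioms unfolding E_def by blast
qed

text \<open>A VPT representation with rooted host tree and with paths as vertex sets. The graph
  enters only through \<open>V\<close> and \<open>adj\<close>, which stay fixed while tree and paths
  are modified.\<close>

locale rooted_rep = rooted_tree N q p d
  for N :: "'t set" and q p d +
  fixes V :: "'v set" and adj :: "'v \<Rightarrow> 'v \<Rightarrow> bool" and X :: "'v \<Rightarrow> 't set"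
  assumes rep_path: "v \<in> V \<Longrightarrow> \<exists>t. path_with_top N q p (X v) t"
    and rep_adj: "u \<in> V \<Longrightarrow> v \<in> V \<Longrightarrow> u \<noteq> v \<Longrightarrow> adj u v \<longleftrightarrow> X u \<inter> X v \<noteq> {}"

text \<open>The root may be chosen freely; it will be a node of too large degree, or a node common
  to all paths of a clique.\<close>

lemma rooted_rep_of_vpt_rep:
  assumes "vpt_rep G T P" "q \<in> verts T"
  shows "\<exists>p d. rooted_rep (verts T) q p d (verts G) (\<lambda>u v. (u, v) \<in> arcs_ends G) (\<lambda>v. set (P v)) \<and>
    (\<forall>x \<in> verts T. node_degree (verts T) q p x = out_degree T x)"
proof -
  have T: "undirected_tree T" using assms by (simp add: vpt_rep_def)
  interpret graph T using T by (simp add: undirected_tree_def)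
  obtain p d where R: "rooted_tree (verts T) q p d" and E: "arcs_ends T = tree_edges (verts T) q p"
    using ex_rooting[OF T assms(2)] by blast
  interpret R: rooted_tree "verts T" q p d by fact
  have "rooted_rep (verts T) q p d (verts G) (\<lambda>u v. (u, v) \<in> arcs_ends G) (\<lambda>v. set (P v))"
  proof
    fix v assume "v \<in> verts G"
    then have "vpath (P v) T" using assms by (simp add: vpt_rep_def)
    then show "\<exists>t. path_with_top (verts T) q p (set (P v)) t"
      using R.path_of_vpath[of "P v"] E by (auto simp: vpath_def vwalk_def)
  qed (use assms in \<open>auto simp: vpt_rep_def\<close>)
  moreover have "node_degree (verts T) q p x = out_degree T x" if "x \<in> verts T" for x
    using R.card_tree_edges[OF that] out_degree_neighbors E by simp
  ultimately show ?thesis by blast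
qed

lemma vpt_rep_of_rooted_rep:
  assumes "rooted_rep N q p d (verts G) (\<lambda>u v. (u, v) \<in> arcs_ends G) X"
  shows "\<exists>(T :: 't pair_pre_digraph) P. vpt_rep G T P \<and> verts T = N \<and> (\<forall>v \<in> verts G. set (P v) = X v) \<and>
    (\<forall>x \<in> verts T. out_degree T x = node_degree N q p x)"
proof -
  interpret rooted_rep N q p d "verts G" "\<lambda>u v. (u, v) \<in> arcs_ends G" X by fact
  interpret T: pair_graph tree_graph by (rule tree_graph_graph)
  have "\<forall>v \<in> verts G. \<exists>l. distinct l \<and> set l = X v \<and> set (vwalk_arcs l) \<subseteq> tree_edges N q p"
    using rep_path vpath_of_path by blast
  then obtain P where P: "\<And>v. v \<in> verts G \<Longrightarrow> distinct (P v) \<and> set (P v) = X v \<and>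
      set (vwalk_arcs (P v)) \<subseteq> tree_edges N q p"
    by metis
  have "vpath (P v) tree_graph" if "v \<in> verts G" for v
    using P[OF that] rep_path[OF that]
    by (auto simp: vpath_def vwalk_def tree_graph_def path_with_top_def)
  then have "vpt_rep G tree_graph P"
    unfolding vpt_rep_def using undirected_tree_tree_graph P rep_adj by simp
  moreover have "out_degree tree_graph x = node_degree N q p x" if "x \<in> N" for x
    using graph.out_degree_neighbors[OF T.pair_graphD_graph, of x] card_tree_edges[OF that]
    by (simp add: tree_graph_def)
  moreover have "verts tree_graph = N" by (simp add: tree_graph_def)
  ultimately show ?thesis using P by metis
qed

section \<open>Crossing neighbourhoods and colourings\<close>

definition crossing :: "'a set \<Rightarrow> 'a set \<Rightarrow> bool" where
  "crossing A B \<longleftrightarrow> A \<inter> B \<noteq> {} \<and> \<not> A \<subseteq> B \<and> \<not> B \<subseteq> A"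

text \<open>The \<open>h\<close>-colourability of the branch graph \<open>B(G/C)\<close> of the literature; there, crossing vertices are also
  required to be nonadjacent, which is automatic in VPT graphs.\<close>

definition branch_colourable :: "('v \<Rightarrow> 'v \<Rightarrow> bool) \<Rightarrow> 'v set \<Rightarrow> 'v set \<Rightarrow> nat \<Rightarrow> bool" where
  "branch_colourable adj V C h \<longleftrightarrow> (\<exists>f :: 'v \<Rightarrow> nat. \<forall>u \<in> V - C. f u < h \<and>
     (\<forall>v \<in> V - C. crossing {c \<in> C. adj u c} {c \<in> C. adj v c} \<longrightarrow> f u \<noteq> f v))"

lemma crossing_sym: "crossing A B \<Longrightarrow> crossing B A"
  by (auto simp: crossing_def)

text \<open>A set that is contained in another one meets no third set, so it can be given any colour other than
  that of the larger set.\<close>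

lemma intersection_colouring:
  fixes A :: "'i::linorder \<Rightarrow> 'a set" and f :: "'i \<Rightarrow> nat"
  assumes two: "\<And>i j k x. i \<in> I \<Longrightarrow> j \<in> I \<Longrightarrow> k \<in> I \<Longrightarrow> x \<in> A i \<Longrightarrow> x \<in> A j \<Longrightarrow> x \<in> A k \<Longrightarrow>
      i = j \<or> i = k \<or> j = k"
    and f: "\<And>i. i \<in> I \<Longrightarrow> f i < h"
    and cross: "\<And>i j. i \<in> I \<Longrightarrow> j \<in> I \<Longrightarrow> crossing (A i) (A j) \<Longrightarrow> f i \<noteq> f j"
    and h: "2 \<le> h"
  shows "\<exists>g :: 'i \<Rightarrow> nat. (\<forall>i \<in> I. g i < h) \<and> (\<forall>i \<in> I. \<forall>j \<in> I. i \<noteq> j \<and> A i \<inter> A j \<noteq> {} \<longrightarrow> g i \<noteq> g j)"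
proof -
  \<comment> \<open>Among equal sets the order of the indices decides, so that two indices never
    dominate each other.\<close>
  define dom where "dom i j \<longleftrightarrow> A i \<noteq> {} \<and> j \<in> I \<and> j \<noteq> i \<and> A i \<subseteq> A j \<and> (A i = A j \<longrightarrow> j < i)" for i j
  have ex: "\<exists>c. c < h \<and> c \<noteq> m" for m :: nat
    using h by (intro exI[of _ "if m = 0 then 1 else 0"]) auto
  define g where "g i = (if \<exists>j. dom i j then SOME c. c < h \<and> c \<noteq> f (SOME j. dom i j) else f i)" for i
  have nodom: "\<not> dom j k" if ij: "dom i j" "i \<in> I" for i j k
  proof
    assume jk: "dom j k"
    obtain x where "x \<in> A i" using ij by (auto simp: dom_def)
    then have "i = k" using two[of i j k x] ij jk by (auto simp: dom_def)
    then show False using ij jk by (auto simp: dom_def)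
  qed
  have uniq: "j = k" if ik: "dom i j" "i \<in> I" "k \<in> I" "k \<noteq> i" "A i \<inter> A k \<noteq> {}" for i j k
  proof -
    obtain x where "x \<in> A i" "x \<in> A k" using ik(5) by blast
    then show ?thesis using two[of i j k x] ik unfolding dom_def by blast
  qed
  have gdom: "g i < h \<and> g i \<noteq> f j" if ij: "dom i j" "i \<in> I" for i j
  proof -
    have "dom i (SOME j. dom i j)" using ij(1) by (rule someI)
    then have "(SOME j. dom i j) = j"
      using uniq[OF ij, of "SOME j. dom i j"] unfolding dom_def by blast
    then have "g i = (SOME c. c < h \<and> c \<noteq> f j)" using ij(1) unfolding g_def by auto
    then show ?thesis using someI_ex[OF ex[of "f j"]] by simp
  qed
  have *: "g i \<noteq> g k" if ik: "dom i j" "i \<in> I" "k \<in> I" "k \<noteq> i" "A i \<inter> A k \<noteq> {}" for i j k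
  proof -
    have "j = k" using uniq[OF ik] .
    then have "\<nexists>l. dom k l" "dom i k" using nodom[of i k] ik by blast+
    then have "g k = f k" unfolding g_def by (metis (no_types, lifting))
    then show ?thesis using gdom[OF \<open>dom i k\<close> ik(2)] by simp
  qed
  have "g i \<noteq> g k" if ik: "i \<in> I" "k \<in> I" "i \<noteq> k" "A i \<inter> A k \<noteq> {}" for i k
  proof -
    consider j where "dom i j" | j where "dom k j" | "\<nexists>j. dom i j" "\<nexists>j. dom k j" by blast
    then show ?thesis
    proof cases
      case 1
      show ?thesis by (rule *[OF 1]) (use ik in auto)
    next
      case 2
      have "g k \<noteq> g i" by (rule *[OF 2]) (use ik in auto)
      then show ?thesis by simp
    next
      case 3
      then have n: "\<not> dom i k" "\<not> dom k i" by blast+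
      have ne: "A i \<noteq> {}" "A k \<noteq> {}" "k < i \<or> i < k" using ik by auto
      then have "A i \<noteq> A k" using n ik(1-3) by (auto simp: dom_def)
      then have "\<not> A i \<subseteq> A k" "\<not> A k \<subseteq> A i"
        using n ik(1-3) ne by (simp_all add: dom_def)
      then have "f i \<noteq> f k" using cross[of i k] ik unfolding crossing_def by blast
      then show ?thesis using 3 by (simp add: g_def)
    qed
  qed
  moreover have "g i < h" if "i \<in> I" for i
    using gdom[of i] f[OF that] that by (cases "\<exists>j. dom i j") (auto simp: g_def)
  ultimately show ?thesis by blast
qed

definition bad_nodes :: "nat \<Rightarrow> 't set \<Rightarrow> 't \<Rightarrow> ('t \<Rightarrow> 't) \<Rightarrow> 't set" where
  "bad_nodes h N q p = {x \<in> N. h < node_degree N q p x}"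

section \<open>The clique of all paths through the root\<close>

context rooted_rep
begin

definition root_clique :: "'v set" where
  "root_clique = {v \<in> V. q \<in> X v}"

definition apex :: "'v \<Rightarrow> 't" where
  "apex v = (SOME t. path_with_top N q p (X v) t)"

lemma apex_path: "v \<in> V \<Longrightarrow> path_with_top N q p (X v) (apex v)"
  unfolding apex_def by (rule someI_ex[OF rep_path])

lemma apex_in: "v \<in> V \<Longrightarrow> apex v \<in> X v" "v \<in> V \<Longrightarrow> X v \<subseteq> N"
  using apex_path by (auto simp: path_with_top_def)

lemma root_path: "v \<in> root_clique \<Longrightarrow> path_with_top N q p (X v) q"
  using apex_path path_top_root unfolding root_clique_def by fastforce

lemma rank_root: "x \<in> N \<Longrightarrow> d q \<le> d x"
  using ancestor_root ancestor_rank by fastforce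

lemma apex_ne_root: "v \<in> V - root_clique \<Longrightarrow> apex v \<noteq> q"
  using apex_in(1)[of v] by (auto simp: root_clique_def)

text \<open>The path of \<open>c\<close> has the root on top, so its top has the smallest rank and
  \<open>path_inter_top\<close> applies. Adjacency to the root clique thus depends on
  \<open>apex v\<close> alone.\<close>

lemma adj_root_clique:
  assumes "c \<in> root_clique" "v \<in> V - root_clique"
  shows "adj v c \<longleftrightarrow> apex v \<in> X c"
proof -
  have cv: "c \<in> V" "v \<in> V" "c \<noteq> v" using assms by (auto simp: root_clique_def)
  have "apex v \<in> X c" if "y \<in> X c \<inter> X v" for y
    using path_inter_top[OF root_path[OF assms(1)] apex_path[OF cv(2)] that] rank_root apex_in cv by blast
  then show ?thesis using rep_adj[of v c] cv apex_in by blast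
qed

lemma nbh_root_clique:
  "v \<in> V - root_clique \<Longrightarrow> {c \<in> root_clique. adj v c} = {c \<in> root_clique. apex v \<in> X c}"
  using adj_root_clique by blast

text \<open>A path through the root that contains \<open>apex v\<close> climbs from there to the
  root and so passes every ancestor of \<open>apex v\<close>.\<close>

lemma nbh_mono:
  assumes u: "u \<in> V - root_clique" and v: "v \<in> V - root_clique" and "ancestor p (apex v) (apex u)"
  shows "{c \<in> root_clique. adj v c} \<subseteq> {c \<in> root_clique. adj u c}"
proof -
  have "d q \<le> d (apex u)" using rank_root apex_in[of u] u by blast
  then have "apex u \<in> X c" if "c \<in> root_clique" "apex v \<in> X c" for c
    using path_upward[OF root_path[OF that(1)] that(2) assms(3)] by simp
  then show ?thesis unfolding nbh_root_clique[OF u] nbh_root_clique[OF v] by auto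
qed

lemma nbh_mono_ancestor:
  assumes "u \<in> V - root_clique" "v \<in> V - root_clique" "ancestor p x (apex u)" "ancestor p x (apex v)"
  shows "{c \<in> root_clique. adj u c} \<subseteq> {c \<in> root_clique. adj v c} \<or>
    {c \<in> root_clique. adj v c} \<subseteq> {c \<in> root_clique. adj u c}"
  using ancestors_comparable[OF assms(3,4)] nbh_mono[OF assms(1,2)] nbh_mono[OF assms(2,1)] by argo

text \<open>A common node of the two paths has both apices as ancestors, so the apices are
  comparable.\<close>

lemma nbh_nested_adjacent:
  assumes u: "u \<in> V - root_clique" and v: "v \<in> V - root_clique" and "u \<noteq> v" "adj u v"
  shows "{c \<in> root_clique. adj u c} \<subseteq> {c \<in> root_clique. adj v c} \<or>
    {c \<in> root_clique. adj v c} \<subseteq> {c \<in> root_clique. adj u c}"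
proof -
  have uv: "u \<in> V" "v \<in> V" using u v by auto
  obtain y where "y \<in> X u" "y \<in> X v" using rep_adj[OF uv] assms(3,4) by auto
  then have "ancestor p y (apex u)" "ancestor p y (apex v)"
    using path_ancestor_top[OF apex_path] uv by auto
  then show ?thesis by (rule nbh_mono_ancestor[OF u v])
qed

text \<open>A common neighbour in the clique has a path through both apices; within one branch this
  path is a chain, so the apices are comparable and the neighbourhoods nested.\<close>

lemma nbh_nested_branch:
  assumes u: "u \<in> V - root_clique" and v: "v \<in> V - root_clique"
    and "branch (apex u) = branch (apex v)"
  shows "\<not> crossing {c \<in> root_clique. adj u c} {c \<in> root_clique. adj v c}"
proof
  assume c: "crossing {c \<in> root_clique. adj u c} {c \<in> root_clique. adj v c}"
  then obtain x where x: "x \<in> root_clique" "adj u x" "adj v x" unfolding crossing_def by auto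
  then have "apex u \<in> X x" "apex v \<in> X x" using adj_root_clique u v by auto
  then have "ancestor p (apex u) (apex v) \<or> ancestor p (apex v) (apex u)"
    using root_path_chain[OF root_path[OF x(1)]] apex_ne_root u v assms(3) by auto
  then show False
    using nbh_mono[OF u v] nbh_mono[OF v u] c unfolding crossing_def by auto
qed

lemma two_branches:
  assumes "c \<in> root_clique" "u \<in> V - root_clique" "v \<in> V - root_clique" "w \<in> V - root_clique"
    and "adj u c" "adj v c" "adj w c"
  shows "branch (apex u) = branch (apex v) \<or> branch (apex u) = branch (apex w) \<or> branch (apex v) = branch (apex w)"
proof -
  have *: "branch (apex u) \<in> X c" "branch (apex u) \<noteq> q" "p (branch (apex u)) = q"
    if u: "u \<in> V - root_clique" "adj u c" for u
  proof -
    have t: "apex u \<in> X c" "apex u \<in> N" "apex u \<noteq> q"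
      using adj_root_clique[OF assms(1) u(1)] u(2) apex_in[of u] apex_ne_root[OF u(1)] u(1) by auto
    note b = branch_props[OF t(2,3)]
    then have "d q \<le> d (branch (apex u))" by (intro rank_root) (simp add: children_def)
    then show "branch (apex u) \<in> X c" by (rule path_upward[OF root_path[OF assms(1)] t(1) b(2)])
    show "branch (apex u) \<noteq> q" "p (branch (apex u)) = q" using b by (auto simp: children_def)
  qed
  show ?thesis
    using path_top_children[OF root_path[OF assms(1)],
        of "branch (apex u)" "branch (apex v)" "branch (apex w)"]
      *[OF assms(2,5)] *[OF assms(3,6)] *[OF assms(4,7)] by simp
qed

text \<open>The top of largest rank lies on every path of the clique, by
  \<open>path_inter_top\<close>.\<close>

lemma helly:
  assumes "C \<subseteq> V" "C \<noteq> {}" "\<And>u v. u \<in> C \<Longrightarrow> v \<in> C \<Longrightarrow> u \<noteq> v \<Longrightarrow> adj u v"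
  shows "\<exists>z \<in> N. \<forall>c \<in> C. z \<in> X c"
proof -
  have ap: "apex c \<in> X c" "apex c \<in> N" "path_with_top N q p (X c) (apex c)" if "c \<in> C" for c
  proof -
    have "c \<in> V" using assms(1) that by auto
    then show "apex c \<in> X c" "apex c \<in> N" "path_with_top N q p (X c) (apex c)"
      using apex_in[of c] apex_path[of c] by auto
  qed
  then have "apex ` C \<subseteq> N" by auto
  then have fin: "finite (apex ` C)" using finite_nodes by (rule finite_subset)
  have "Max (d ` apex ` C) \<in> d ` apex ` C" using fin assms(2) by (intro Max_in) auto
  then obtain a where a: "a \<in> C" "Max (d ` apex ` C) = d (apex a)" by auto
  have "apex a \<in> X c" if c: "c \<in> C" for c
  proof (cases "c = a")
    case False
    have "c \<in> V" "a \<in> V" using assms(1) a(1) c by auto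
    then have "X c \<inter> X a \<noteq> {}" using rep_adj False assms(3)[OF c a(1) False] by simp
    then obtain y where y: "y \<in> X c \<inter> X a" by blast
    have "d (apex c) \<le> d (apex a)"
      using Max_ge[of "d ` apex ` C" "d (apex c)"] fin c a by auto
    then show ?thesis by (rule path_inter_top[OF ap(3)[OF c] ap(3)[OF a(1)] y])
  qed (use ap a in simp)
  then show ?thesis using ap(2)[OF a(1)] by (intro bexI[of _ "apex a"] ballI)
qed

text \<open>The colour of a vertex is the number of the branch that contains its apex; vertices in
  the same branch do not cross.\<close>

lemma branch_colourable_of_degree:
  assumes C: "C \<subseteq> root_clique" and h: "node_degree N q p q \<le> h" "0 < h"
  shows "branch_colourable adj V C h"
proof -
  obtain b where b: "bij_betw b (children N q p q) {..<card (children N q p q)}"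
    using ex_bij_betw_finite_nat[OF finite_children] by (auto simp: atLeast0LessThan)
  \<comment> \<open>The colour 0 on \<open>root_clique - C\<close> is harmless: such a vertex is
    adjacent to all of \<open>C\<close>, so it crosses nothing.\<close>
  define f where "f v = (if v \<in> root_clique then 0 else b (branch (apex v)))" for v
  have CV: "C \<subseteq> V" using C by (auto simp: root_clique_def)
  have br: "branch (apex v) \<in> children N q p q" if "v \<in> V - root_clique" for v
    using branch_props(1) apex_in apex_ne_root that by blast
  have "f u < h" if "u \<in> V - C" for u
  proof (cases "u \<in> root_clique")
    case False
    then have "b (branch (apex u)) \<in> {..<card (children N q p q)}"
      using br that b by (auto simp: bij_betw_def)
    then show ?thesis using h False by (auto simp: f_def node_degree_def)
  qed (use h in \<open>simp add: f_def\<close>)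
  moreover have "f u \<noteq> f v" if uv: "u \<in> V - C" "v \<in> V - C"
      and cr: "crossing {c \<in> C. adj u c} {c \<in> C. adj v c}" for u v
  proof
    assume eq: "f u = f v"
    have full: "{c \<in> C. adj w c} = C" if "w \<in> root_clique" "w \<in> V - C" for w
      using that C CV rep_adj[of w] by (auto simp: root_clique_def)
    have uv': "u \<in> V - root_clique" "v \<in> V - root_clique"
      using full[of u] full[of v] cr uv by (auto simp: crossing_def)
    then have "b (branch (apex u)) = b (branch (apex v))" using eq by (simp add: f_def)
    then have "branch (apex u) = branch (apex v)"
      using inj_onD[OF bij_betw_imp_inj_on[OF b]] br uv' by auto
    with uv' have "\<not> crossing {c \<in> root_clique. adj u c} {c \<in> root_clique. adj v c}"
      by (rule nbh_nested_branch)
    then show False using cr C by (auto simp: crossing_def)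
  qed
  ultimately show ?thesis unfolding branch_colourable_def by auto
qed

end

section \<open>Reducing the degree of a node\<close>

context rooted_rep
begin

lemma apex_pathD:
  assumes "v \<in> V"
  shows "X v \<subseteq> N" "apex v \<in> X v" "\<And>s. s \<in> X v \<Longrightarrow> s \<noteq> apex v \<Longrightarrow> s \<noteq> q \<and> p s \<in> X v"
    "\<And>y. y \<in> X v \<Longrightarrow> card (children N q p y \<inter> X v) \<le> (if y = apex v then 2 else 1)"
    "q \<in> X v \<Longrightarrow> apex v = q"
  using apex_path[OF assms] unfolding path_with_top_def by auto

text \<open>By \<open>rq\<close> every path through \<open>r\<close> also contains \<open>q\<close>,
  so removing \<open>r\<close> neither empties a path nor separates two that meet. The children of
  \<open>r\<close> move up to \<open>q\<close>, and no degree other than that of \<open>q\<close>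
  changes.\<close>

lemma contract_root_edge:
  assumes r: "r \<in> children N q p q" and rq: "\<And>v. v \<in> V \<Longrightarrow> r \<in> X v \<Longrightarrow> q \<in> X v"
  defines "p' \<equiv> \<lambda>x. if p x = r then q else p x"
  shows "rooted_rep (N - {r}) q p' d V adj (\<lambda>v. X v - {r})"
    and "\<And>x. x \<in> N - {r} \<Longrightarrow> x \<noteq> q \<Longrightarrow> node_degree (N - {r}) q p' x = node_degree N q p x"
proof -
  have r': "r \<in> N" "r \<noteq> q" "p r = q" using r by (auto simp: children_def)
  have ch: "children (N - {r}) q p' x = children N q p x" if "x \<noteq> q" "x \<noteq> r" for x
    using that r' by (auto simp: children_def p'_def)
  have chq: "children (N - {r}) q p' q \<subseteq> (children N q p q - {r}) \<union> children N q p r"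
    by (auto simp: children_def p'_def split: if_splits)
  show "rooted_rep (N - {r}) q p' d V adj (\<lambda>v. X v - {r})"
  proof
    show "d (p' x) < d x" if "x \<in> N - {r}" "x \<noteq> q" for x
      using rank_parent[of x] rank_parent[of r] that r' by (auto simp: p'_def)
    show "p' x \<in> N - {r}" if "x \<in> N - {r}" "x \<noteq> q" for x
      using that root_in r' parent_in by (auto simp: p'_def)
    fix v assume v: "v \<in> V"
    define t where "t = apex v"
    note t = apex_pathD[OF v, folded t_def]
    have tr: "t \<noteq> r" using rq[OF v] t(2,5) r' by auto
    have "card (children (N - {r}) q p' y \<inter> (X v - {r})) \<le> (if y = t then 2 else 1)"
      if y: "y \<in> X v - {r}" for y
    proof (cases "y = q")
      case False
      then have "children (N - {r}) q p' y \<inter> (X v - {r}) \<subseteq> children N q p y \<inter> X v"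
        using ch y by auto
      then have "card (children (N - {r}) q p' y \<inter> (X v - {r})) \<le> card (children N q p y \<inter> X v)"
        using finite_children by (intro card_mono) auto
      then show ?thesis using t(4)[of y] y by simp
    next
      case True
      then have tq: "t = q" "q \<in> X v" using t(5) y by auto
      \<comment> \<open>At \<open>q\<close> the child \<open>r\<close> is replaced by its own
        children. A path through \<open>r\<close> contains at most one of them, as \<open>r\<close>
        is not its top; a path avoiding \<open>r\<close> contains none.\<close>
      define A B where "A = children N q p q \<inter> X v" and "B = children N q p r \<inter> X v"
      have fin: "finite A" "finite B" using finite_children by (auto simp: A_def B_def)
      have sub: "children (N - {r}) q p' q \<inter> (X v - {r}) \<subseteq> (A - {r}) \<union> B"
        using chq by (auto simp: A_def B_def)
      have A2: "card A \<le> 2" using t(4)[OF tq(2)] tq by (simp add: A_def)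
      have "card ((A - {r}) \<union> B) \<le> 2"
      proof (cases "r \<in> X v")
        case True
        then have "card B \<le> 1" using t(4)[of r] tr by (simp add: B_def)
        moreover have "card (A - {r}) < card A"
          using True r fin by (intro card_Diff1_less) (auto simp: A_def)
        ultimately show ?thesis using A2 card_Un_le[of "A - {r}" B] by linarith
      next
        case False
        have "c \<notin> X v" if "c \<in> children N q p r" for c
        proof
          assume "c \<in> X v"
          moreover have "c \<noteq> q" "p c = r" using that by (auto simp: children_def)
          ultimately show False using t(3)[of c] tq False by auto
        qed
        then have "B = {}" by (auto simp: B_def)
        then show ?thesis using A2 card_Diff1_le[of A r] by simp
      qed
      then have "card (children (N - {r}) q p' q \<inter> (X v - {r})) \<le> 2"
        using card_mono[OF _ sub] fin by simp
      then show ?thesis using True tq by simp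
    qed
    moreover have "s \<noteq> q \<and> p' s \<in> X v - {r}" if "s \<in> X v - {r}" "s \<noteq> t" for s
      using t(3)[of s] that rq[OF v] r' by (auto simp: p'_def)
    ultimately show "\<exists>t. path_with_top (N - {r}) q p' (X v - {r}) t"
      using t(1,2) tr unfolding path_with_top_def by (intro exI[of _ t]) auto
  next
    fix u v assume uv: "u \<in> V" "v \<in> V" "u \<noteq> v"
    have "X u \<inter> X v \<noteq> {} \<longleftrightarrow> (X u - {r}) \<inter> (X v - {r}) \<noteq> {}"
      using rq[OF uv(1)] rq[OF uv(2)] r'(2) by blast
    then show "adj u v \<longleftrightarrow> (X u - {r}) \<inter> (X v - {r}) \<noteq> {}"
      using rep_adj[OF uv] by simp
  qed (use finite_nodes root_in r' parent_root in \<open>auto simp: p'_def\<close>)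
  show "node_degree (N - {r}) q p' x = node_degree N q p x" if "x \<in> N - {r}" "x \<noteq> q" for x
    using ch[of x] that by (simp add: node_degree_def)
qed

text \<open>The branches \<open>r\<close> and \<open>s\<close> are hung below a new child
  \<open>z\<close> of \<open>q\<close>, and paths from \<open>q\<close> into either are routed
  through \<open>z\<close>. By \<open>disj\<close> none needs both children of \<open>z\<close>.
  Paths meeting in \<open>z\<close> already meet in \<open>q\<close>, so adjacency is kept. Doubling
  the ranks makes room for \<open>z\<close> between \<open>q\<close> and its children.\<close>

lemma merge_root_edges:
  assumes r: "r \<in> children N q p q" "s \<in> children N q p q" "r \<noteq> s"
    and disj: "\<forall>v \<in> V. q \<in> X v \<longrightarrow> \<not> (r \<in> X v \<and> s \<in> X v)"
    and z: "z \<notin> N"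
  defines "p' \<equiv> \<lambda>x. if x = z then q else if x = r \<or> x = s then z else p x"
    and "X' \<equiv> \<lambda>v. if q \<in> X v \<and> (r \<in> X v \<or> s \<in> X v) then insert z (X v) else X v"
  shows "rooted_rep (insert z N) q p' (\<lambda>x. if x = z then 2 * d q + 1 else 2 * d x) V adj X'"
    and "\<And>x. x \<in> N \<Longrightarrow> x \<noteq> q \<Longrightarrow> node_degree (insert z N) q p' x = node_degree N q p x"
    and "children (insert z N) q p' q = insert z (children N q p q - {r, s})"
    and "node_degree (insert z N) q p' z = 3"
proof -
  have rs: "r \<in> N" "r \<noteq> q" "p r = q" "s \<in> N" "s \<noteq> q" "p s = q"
    using r by (auto simp: children_def)
  have zn: "z \<noteq> r" "z \<noteq> s" "z \<noteq> q" "\<And>x. x \<in> N \<Longrightarrow> x \<noteq> z" "\<And>x. x \<in> N \<Longrightarrow> p x \<noteq> z"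
    using z rs root_in parent_in' by auto
  have ch: "children (insert z N) q p' x = children N q p x" if "x \<noteq> q" "x \<noteq> z" for x
    using that rs zn by (auto simp: children_def p'_def)
  show chq: "children (insert z N) q p' q = insert z (children N q p q - {r, s})"
    using rs zn by (auto simp: children_def p'_def)
  have chz: "children (insert z N) q p' z = {r, s}"
    using rs zn by (auto simp: children_def p'_def)
  have zX: "z \<notin> X v" if "v \<in> V" for v
    using apex_in(2)[OF that] z by auto
  show "rooted_rep (insert z N) q p' (\<lambda>x. if x = z then 2 * d q + 1 else 2 * d x) V adj X'"
  proof
    show "finite (insert z N)" "q \<in> insert z N" using finite_nodes root_in by auto
    show "p' q = q" using zn rs parent_root by (auto simp: p'_def)
    show "p' x \<in> insert z N" if "x \<in> insert z N" "x \<noteq> q" for x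
      using that parent_in root_in by (auto simp: p'_def)
    show "(if p' x = z then 2 * d q + 1 else 2 * d (p' x)) < (if x = z then 2 * d q + 1 else 2 * d x)"
      if "x \<in> insert z N" "x \<noteq> q" for x
      using that rank_parent[of x] rank_parent[of r] rank_parent[of s] rs zn by (auto simp: p'_def)
    show "adj u v \<longleftrightarrow> X' u \<inter> X' v \<noteq> {}" if uv: "u \<in> V" "v \<in> V" "u \<noteq> v" for u v
      using rep_adj[OF uv] zX[OF uv(1)] zX[OF uv(2)] by (auto simp: X'_def)
    fix v assume v: "v \<in> V"
    define t where "t = apex v"
    note t = apex_pathD[OF v, folded t_def]
    show "\<exists>t. path_with_top (insert z N) q p' (X' v) t"
    proof (cases "q \<in> X v \<and> (r \<in> X v \<or> s \<in> X v)")
      case True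
      then obtain a where a: "a \<in> X v" "{r, s} \<inter> X v = {a}" "a = r \<or> a = s"
        using disj v by auto
      have tq: "t = q" "X' v = insert z (X v)" using True t(5) by (auto simp: X'_def)
      have "card (children (insert z N) q p' y \<inter> insert z (X v)) \<le> (if y = q then 2 else 1)"
        if "y \<in> insert z (X v)" for y
      proof -
        consider "y = q" | "y = z" | "y \<in> X v" "y \<noteq> q" "y \<noteq> z" using \<open>y \<in> insert z (X v)\<close> by blast
        then show ?thesis
        proof cases
          case 1
          define A where "A = children N q p q \<inter> X v"
          have "finite A" using finite_children by (simp add: A_def)
          have "a \<in> A" using a r by (auto simp: A_def)
          have "children (insert z N) q p' q \<inter> insert z (X v) = insert z (A - {a})"
            using chq a z by (auto simp: A_def)
          then have "card (children (insert z N) q p' q \<inter> insert z (X v)) \<le> Suc (card (A - {a}))"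
            using \<open>finite A\<close> card_insert_le_m1 by (simp add: card_insert_if)
          also have "\<dots> = card A" using \<open>finite A\<close> \<open>a \<in> A\<close> by (rule card_Suc_Diff1)
          also have "\<dots> \<le> 2" using t(4)[of q] tq True by (simp add: A_def)
          finally show ?thesis using 1 by simp
        next
          case 2
          have "children (insert z N) q p' z \<inter> insert z (X v) = {a}" using chz a zn by auto
          then show ?thesis using 2 by simp
        next
          case 3
          then have "children (insert z N) q p' y \<inter> insert z (X v) = children N q p y \<inter> X v"
            using ch[of y] z by (auto simp: children_def)
          then show ?thesis using t(4)[of y] 3 tq by simp
        qed
      qed
      moreover have "x \<noteq> q \<and> p' x \<in> insert z (X v)" if "x \<in> insert z (X v)" "x \<noteq> q" for x
        using t(3)[of x] that True tq zn by (auto simp: p'_def)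
      ultimately show ?thesis
        using t(1,2) tq unfolding path_with_top_def by (intro exI[of _ q]) auto
    next
      case False
      then have X': "X' v = X v" by (auto simp: X'_def)
      have "card (children (insert z N) q p' y \<inter> X v) \<le> (if y = t then 2 else 1)" if y: "y \<in> X v" for y
      proof -
        have "children (insert z N) q p' y \<inter> X v \<subseteq> children N q p y \<inter> X v"
          using ch[of y] chq zX[OF v] y by (cases "y = q") auto
        then have "card (children (insert z N) q p' y \<inter> X v) \<le> card (children N q p y \<inter> X v)"
          using finite_children by (intro card_mono) auto
        then show ?thesis using t(4)[OF y] by simp
      qed
      moreover have "x \<noteq> q \<and> p' x \<in> X v" if "x \<in> X v" "x \<noteq> t" for x
        using t(3)[OF that] that False rs zX[OF v] by (auto simp: p'_def)
      ultimately show ?thesis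
        using t(1,2) unfolding X' path_with_top_def by (intro exI[of _ t]) auto
    qed
  qed
  show "node_degree (insert z N) q p' x = node_degree N q p x" if "x \<in> N" "x \<noteq> q" for x
    using ch[OF that(2) zn(4)[OF that(1)]] by (simp add: node_degree_def)
  show "node_degree (insert z N) q p' z = 3"
    using chz zn r(3) by (simp add: node_degree_def)
qed

end

text \<open>Contraction is repeated until every branch at \<open>q\<close> has a witness: a vertex
  whose path contains the child of \<open>q\<close> but not \<open>q\<close>. Through these
  witnesses a colouring of vertices becomes one of branches.\<close>

lemma contract_root_edges:
  assumes "rooted_rep N q p d V adj X"
  shows "\<exists>N' p' X'. rooted_rep N' q p' d V adj X' \<and>
    (\<forall>r \<in> children N' q p' q. \<exists>v \<in> V. r \<in> X' v \<and> q \<notin> X' v) \<and>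
    (\<forall>v. q \<in> X' v \<longleftrightarrow> q \<in> X v) \<and> bad_nodes h N' q p' - {q} \<subseteq> bad_nodes h N q p - {q}"
  using assms
proof (induction "card N" arbitrary: N p X rule: less_induct)
  case less
  interpret rooted_rep N q p d V adj X by fact
  show ?case
  proof (cases "\<forall>r \<in> children N q p q. \<exists>v \<in> V. r \<in> X v \<and> q \<notin> X v")
    case True
    then show ?thesis using less.prems by blast
  next
    case False
    then obtain r where r: "r \<in> children N q p q" and rq: "\<And>v. v \<in> V \<Longrightarrow> r \<in> X v \<Longrightarrow> q \<in> X v" by blast
    note c = contract_root_edge[OF r rq]
    have r': "r \<in> N" "r \<noteq> q" using r by (auto simp: children_def)
    then have "card (N - {r}) < card N" using finite_nodes by (intro card_Diff1_less)
    from less.hyps[OF this c(1)] obtain N' p' X' where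
      IH: "rooted_rep N' q p' d V adj X'" "\<forall>r \<in> children N' q p' q. \<exists>v \<in> V. r \<in> X' v \<and> q \<notin> X' v"
        "\<forall>v. q \<in> X' v \<longleftrightarrow> q \<in> X v - {r}"
        "bad_nodes h N' q p' - {q} \<subseteq> bad_nodes h (N - {r}) q (\<lambda>x. if p x = r then q else p x) - {q}"
      by blast
    have "bad_nodes h (N - {r}) q (\<lambda>x. if p x = r then q else p x) - {q} \<subseteq> bad_nodes h N q p - {q}"
      using c(2) by (auto simp: bad_nodes_def)
    then show ?thesis using IH r'(2) by (intro exI[of _ N'] exI[of _ p'] exI[of _ X']) auto
  qed
qed

text \<open>While \<open>q\<close> has more than \<open>h\<close> children, two of them share a
  colour by the pigeonhole principle and are merged. The new node has degree 3, which is at most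
  \<open>h\<close>, and inherits the shared colour.\<close>

lemma merge_branches:
  fixes N :: "nat set"
  assumes "rooted_rep N q p d V adj X" and h: "3 \<le> h"
    and "\<And>r. r \<in> children N q p q \<Longrightarrow> g r < h"
    and "\<And>r s v. r \<in> children N q p q \<Longrightarrow> s \<in> children N q p q \<Longrightarrow> r \<noteq> s \<Longrightarrow> v \<in> V \<Longrightarrow>
      q \<in> X v \<Longrightarrow> r \<in> X v \<Longrightarrow> s \<in> X v \<Longrightarrow> g r \<noteq> g s"
  shows "\<exists>N' p' d' X'. rooted_rep N' q p' d' V adj X' \<and> bad_nodes h N' q p' \<subseteq> bad_nodes h N q p - {q}"
  using assms(1,3,4)
proof (induction "card (children N q p q)" arbitrary: N p d X g rule: less_induct)
  case less
  note gh = less.prems(2) and gdiff = less.prems(3)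
  interpret rooted_rep N q p d V adj X by fact
  show ?case
  proof (cases "card (children N q p q) \<le> h")
    case True
    then have "q \<notin> bad_nodes h N q p" by (simp add: bad_nodes_def node_degree_def)
    then show ?thesis using less.prems(1) by blast
  next
    case False
    have "\<not> inj_on g (children N q p q)"
    proof
      assume "inj_on g (children N q p q)"
      then have "card (children N q p q) \<le> card {..<h}"
        using gh by (intro card_inj_on_le[of g]) auto
      then show False using False by simp
    qed
    then obtain r s where rs: "r \<in> children N q p q" "s \<in> children N q p q" "r \<noteq> s" "g r = g s"
      unfolding inj_on_def by blast
    obtain z where z: "z \<notin> N" using finite_nodes ex_new_if_finite infinite_UNIV_nat by blast
    have disj: "\<forall>v \<in> V. q \<in> X v \<longrightarrow> \<not> (r \<in> X v \<and> s \<in> X v)"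
      using gdiff[OF rs(1-3)] rs(4) by blast
    note m = merge_root_edges[OF rs(1-3) disj z]
    let ?N = "insert z N" and ?p = "\<lambda>x. if x = z then q else if x = r \<or> x = s then z else p x"
      and ?X = "\<lambda>v. if q \<in> X v \<and> (r \<in> X v \<or> s \<in> X v) then insert z (X v) else X v"
      and ?g = "\<lambda>x. if x = z then g r else g x"
    have zq: "z \<noteq> q" "z \<notin> children N q p q" using z root_in by (auto simp: children_def)
    have "bad_nodes h ?N q ?p - {q} \<subseteq> bad_nodes h N q p - {q}"
      using m(2,4) h z by (auto simp: bad_nodes_def)
    moreover have "card (children ?N q ?p q) < card (children N q p q)"
    proof -
      have "card (children ?N q ?p q) = Suc (card (children N q p q - {r, s}))"
        using m(3) zq finite_children by simp
      also have "card (children N q p q - {r, s}) = card (children N q p q) - 2"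
        using rs finite_children by (subst card_Diff_subset) auto
      finally show ?thesis using False h by simp
    qed
    moreover have "?g x < h" if "x \<in> children ?N q ?p q" for x
    proof -
      have "x = z \<or> x \<in> children N q p q" using that m(3) by auto
      then show ?thesis using gh rs(1) by auto
    qed
    moreover have "?g x \<noteq> ?g y"
      if xy: "x \<in> children ?N q ?p q" "y \<in> children ?N q ?p q" "x \<noteq> y" and v: "v \<in> V"
        "q \<in> ?X v" "x \<in> ?X v" "y \<in> ?X v" for x y v
    proof -
      have q: "q \<in> X v" using v(2) zq by (auto split: if_splits)
      have *: "w = z \<or> (w \<in> children N q p q \<and> w \<noteq> r \<and> w \<noteq> s \<and> w \<in> X v \<and> w \<noteq> z)"
        if "w \<in> children ?N q ?p q" "w \<in> ?X v" for w
      proof -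
        have "w = z \<or> (w \<in> children N q p q \<and> w \<noteq> r \<and> w \<noteq> s)" using that(1) m(3) by auto
        moreover have "w = z \<or> w \<in> X v" using that(2) by (auto split: if_splits)
        ultimately show ?thesis using zq by auto
      qed
      \<comment> \<open>A path through \<open>q\<close> and \<open>z\<close> used \<open>r\<close>
        or \<open>s\<close> before, so the old condition applies to that child, whose colour
        \<open>z\<close> has.\<close>
      have **: "g r \<noteq> g w" if "z \<in> ?X v" "w \<in> children N q p q" "w \<noteq> r" "w \<noteq> s" "w \<in> X v" for w
      proof -
        have "z \<notin> X v" using apex_in(2)[OF v(1)] z by auto
        then have "r \<in> X v \<or> s \<in> X v" using that(1) by (auto split: if_splits)
        then show ?thesis
          using gdiff[OF rs(1) that(2) _ v(1) q] gdiff[OF rs(2) that(2) _ v(1) q] that rs(4) by auto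
      qed
      have vz: "z \<in> ?X v" if "x = z \<or> y = z" using that v by auto
      show ?thesis
        using *[OF xy(1) v(3)] *[OF xy(2) v(4)]
      proof (elim disjE)
        assume "x = z" "y = z" then show ?thesis using xy by simp
      next
        assume x: "x = z" and y: "y \<in> children N q p q \<and> y \<noteq> r \<and> y \<noteq> s \<and> y \<in> X v \<and> y \<noteq> z"
        then show ?thesis using **[OF vz, of y] by simp
      next
        assume y: "y = z" and x: "x \<in> children N q p q \<and> x \<noteq> r \<and> x \<noteq> s \<and> x \<in> X v \<and> x \<noteq> z"
        then show ?thesis using **[OF vz, of x] by simp
      next
        assume x: "x \<in> children N q p q \<and> x \<noteq> r \<and> x \<noteq> s \<and> x \<in> X v \<and> x \<noteq> z"
          and y: "y \<in> children N q p q \<and> y \<noteq> r \<and> y \<noteq> s \<and> y \<in> X v \<and> y \<noteq> z"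
        then show ?thesis using gdiff[of x y v] xy(3) v(1) q by simp
      qed
    qed
    ultimately obtain N' p' d' X' where IH: "rooted_rep N' q p' d' V adj X'"
        "bad_nodes h N' q p' \<subseteq> bad_nodes h ?N q ?p - {q}"
      using less.hyps[OF _ m(1), of ?g] by blast
    then show ?thesis using \<open>bad_nodes h ?N q ?p - {q} \<subseteq> bad_nodes h N q p - {q}\<close>
      by (meson order_trans)
  qed
qed

text \<open>After contraction, the witness \<open>w r\<close> of a branch \<open>r\<close> transfers
  its colour to \<open>r\<close>. This separates crossing sets \<open>A r\<close> only;
  \<open>intersection_colouring\<close> improves it to all intersecting ones, as
  \<open>merge_branches\<close> requires.\<close>

lemma reduce_bad_node:
  fixes N :: "nat set"
  assumes R: "rooted_rep N q p d V adj X" and h: "3 \<le> h"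
    and col: "branch_colourable adj V {v \<in> V. q \<in> X v} h"
  shows "\<exists>N' p' d' X'. rooted_rep N' q p' d' V adj X' \<and> bad_nodes h N' q p' \<subseteq> bad_nodes h N q p - {q}"
proof -
  obtain N1 p1 X1 where R1: "rooted_rep N1 q p1 d V adj X1"
      and ch: "\<forall>r \<in> children N1 q p1 q. \<exists>v \<in> V. r \<in> X1 v \<and> q \<notin> X1 v"
      and q1: "\<forall>v. q \<in> X1 v \<longleftrightarrow> q \<in> X v" and bad1: "bad_nodes h N1 q p1 - {q} \<subseteq> bad_nodes h N q p - {q}"
    using contract_root_edges[OF R, of h] by (elim exE conjE)
  interpret rooted_rep N1 q p1 d V adj X1 by fact
  have C: "{v \<in> V. q \<in> X v} = root_clique" using q1 by (auto simp: root_clique_def)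
  obtain f :: "'a \<Rightarrow> nat" where f: "\<And>u. u \<in> V - root_clique \<Longrightarrow> f u < h"
      "\<And>u v. u \<in> V - root_clique \<Longrightarrow> v \<in> V - root_clique \<Longrightarrow>
        crossing {c \<in> root_clique. adj u c} {c \<in> root_clique. adj v c} \<Longrightarrow> f u \<noteq> f v"
    using col unfolding branch_colourable_def C by meson
  have "\<forall>r \<in> children N1 q p1 q. \<exists>v. v \<in> V \<and> r \<in> X1 v \<and> q \<notin> X1 v" using ch by blast
  from bchoice[OF this] obtain w where
      w: "\<And>r. r \<in> children N1 q p1 q \<Longrightarrow> w r \<in> V \<and> r \<in> X1 (w r) \<and> q \<notin> X1 (w r)"
    by blast
  define A where "A r = {c \<in> root_clique. r \<in> X1 c}" for r
  have wV: "w r \<in> V - root_clique" if "r \<in> children N1 q p1 q" for r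
    using w[OF that] by (simp add: root_clique_def)
  \<comment> \<open>The child \<open>r\<close> is the apex of \<open>w r\<close>, for otherwise its
    parent \<open>q\<close> would be on that path.\<close>
  have wA: "{c \<in> root_clique. adj (w r) c} = A r" if r: "r \<in> children N1 q p1 q" for r
  proof -
    have "r = apex (w r)"
    proof (rule ccontr)
      assume "r \<noteq> apex (w r)"
      then have "p1 r \<in> X1 (w r)"
        using apex_path[of "w r"] w[OF r] by (auto simp: path_with_top_def)
      then show False using w[OF r] r by (simp add: children_def)
    qed
    then show ?thesis using nbh_root_clique[OF wV[OF r]] by (simp add: A_def)
  qed
  have two: "i = j \<or> i = k \<or> j = k" if "i \<in> children N1 q p1 q" "j \<in> children N1 q p1 q" "k \<in> children N1 q p1 q"
      "x \<in> A i" "x \<in> A j" "x \<in> A k" for i j k x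
  proof (rule path_top_children)
    show "path_with_top N1 q p1 (X1 x) q" using root_path that by (simp add: A_def)
  qed (use that in \<open>simp_all add: A_def children_def\<close>)
  have "\<exists>g :: nat \<Rightarrow> nat. (\<forall>i \<in> children N1 q p1 q. g i < h) \<and>
      (\<forall>i \<in> children N1 q p1 q. \<forall>j \<in> children N1 q p1 q. i \<noteq> j \<and> A i \<inter> A j \<noteq> {} \<longrightarrow> g i \<noteq> g j)"
  proof (rule intersection_colouring[where f = "\<lambda>r. f (w r)"])
    fix i j assume ij: "i \<in> children N1 q p1 q" "j \<in> children N1 q p1 q" and "crossing (A i) (A j)"
    then show "f (w i) \<noteq> f (w j)" using f(2)[OF wV[OF ij(1)] wV[OF ij(2)]] wA by simp
  next
    show "i = j \<or> i = k \<or> j = k" if "i \<in> children N1 q p1 q" "j \<in> children N1 q p1 q"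
        "k \<in> children N1 q p1 q" "x \<in> A i" "x \<in> A j" "x \<in> A k" for i j k x
      by (rule two[OF that])
    show "f (w i) < h" if "i \<in> children N1 q p1 q" for i
      by (rule f(1)[OF wV[OF that]])
    show "2 \<le> h" using h by simp
  qed
  then obtain g :: "nat \<Rightarrow> nat" where g: "\<And>i. i \<in> children N1 q p1 q \<Longrightarrow> g i < h"
      "\<And>i j. i \<in> children N1 q p1 q \<Longrightarrow> j \<in> children N1 q p1 q \<Longrightarrow> i \<noteq> j \<Longrightarrow> A i \<inter> A j \<noteq> {} \<Longrightarrow> g i \<noteq> g j"
    by blast
  have gd: "g r \<noteq> g s" if "r \<in> children N1 q p1 q" "s \<in> children N1 q p1 q" "r \<noteq> s" "v \<in> V"
      "q \<in> X1 v" "r \<in> X1 v" "s \<in> X1 v" for r s v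
  proof -
    have "v \<in> A r \<inter> A s" using that by (simp add: A_def root_clique_def)
    then show ?thesis using g(2)[OF that(1-3)] by auto
  qed
  have "\<exists>N' p' d' X'. rooted_rep N' q p' d' V adj X' \<and> bad_nodes h N' q p' \<subseteq> bad_nodes h N1 q p1 - {q}"
    by (rule merge_branches[OF R1 h]) (fact g(1), fact gd)
  then show ?thesis using bad1 by (meson order_trans)
qed

section \<open>Minimal graphs outside \<open>[h,2,1]\<close>\<close>

text \<open>Induction on the number of nodes of degree above \<open>h\<close>. One exists as the
  graph is not in the class; the tree is rooted there, and if the clique at this root is colourable,
  \<open>reduce_bad_node\<close> removes it from the bad nodes without creating others.\<close>

lemma reduction_to_uncolourable_root:
  assumes "VPT G" "\<not> in_h21 h G" and h: "3 \<le> h"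
  shows "\<exists>(N :: nat set) q p d X. rooted_rep N q p d (verts G) (\<lambda>u v. (u, v) \<in> arcs_ends G) X \<and>
    \<not> branch_colourable (\<lambda>u v. (u, v) \<in> arcs_ends G) (verts G) {v \<in> verts G. q \<in> X v} h"
proof -
  let ?adj = "\<lambda>u v. (u, v) \<in> arcs_ends G"
  have "?thesis" if "vpt_rep G T P" for T :: "nat pair_pre_digraph" and P
    using that
  proof (induction "card {x \<in> verts T. h < out_degree T x}" arbitrary: T P rule: less_induct)
    case less
    obtain q where q: "q \<in> verts T" "h < out_degree T q"
      using assms(2) less.prems by (auto simp: in_h21_def not_le)
    obtain p d where R: "rooted_rep (verts T) q p d (verts G) ?adj (\<lambda>v. set (P v))"
        and deg: "\<forall>x \<in> verts T. node_degree (verts T) q p x = out_degree T x"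
      using rooted_rep_of_vpt_rep[OF less.prems q(1)] by blast
    show ?case
    proof (cases "branch_colourable ?adj (verts G) {v \<in> verts G. q \<in> set (P v)} h")
      case False
      show ?thesis by (intro exI conjI) (rule R, rule False)
    next
      case True
      obtain N' p' d' X' where R': "rooted_rep N' q p' d' (verts G) ?adj X'"
          and bad: "bad_nodes h N' q p' \<subseteq> bad_nodes h (verts T) q p - {q}"
        using reduce_bad_node[OF R h True] by (elim exE conjE)
      obtain T' :: "nat pair_pre_digraph" and P' where T': "vpt_rep G T' P'" "verts T' = N'"
          "\<forall>x \<in> verts T'. out_degree T' x = node_degree N' q p' x"
        using vpt_rep_of_rooted_rep[OF R'] by (elim exE conjE)
      have B: "bad_nodes h (verts T) q p = {x \<in> verts T. h < out_degree T x}"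
        using deg by (auto simp: bad_nodes_def)
      have B': "bad_nodes h N' q p' = {x \<in> verts T'. h < out_degree T' x}"
        using T' by (auto simp: bad_nodes_def)
      have "finite (verts T)" by (rule rooted_tree.finite_nodes[OF rooted_rep.axioms(1)[OF R]])
      then have "card {x \<in> verts T'. h < out_degree T' x} < card {x \<in> verts T. h < out_degree T x}"
        using bad q unfolding B B' by (intro psubset_card_mono) auto
      from less.hyps[OF this T'(1)] show ?thesis .
    qed
  qed
  then show ?thesis using assms(1) unfolding VPT_def by blast
qed

lemma clique_colourable_of_h21:
  assumes H: "in_h21 h H" and h: "0 < h" and C: "C \<subseteq> verts H"
    and adj: "\<And>u v. u \<in> C \<Longrightarrow> v \<in> C \<Longrightarrow> u \<noteq> v \<Longrightarrow> (u, v) \<in> arcs_ends H"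
  shows "branch_colourable (\<lambda>u v. (u, v) \<in> arcs_ends H) (verts H) C h"
proof (cases "C = {}")
  case True
  then show ?thesis
    using h unfolding branch_colourable_def by (intro exI[of _ "\<lambda>_. 0"]) (simp add: crossing_def)
next
  case False
  obtain T :: "nat pair_pre_digraph" and P where T: "vpt_rep H T P" "\<forall>x \<in> verts T. out_degree T x \<le> h"
    using H unfolding in_h21_def by blast
  obtain c where c: "c \<in> C" using False by blast
  have "vpath (P c) T" using T(1) C c unfolding vpt_rep_def by blast
  \<comment> \<open>Any node serves as a first root for applying \<open>helly\<close>; the tree is
    then rooted again at the common node \<open>z\<close>.\<close>
  then obtain q where "q \<in> verts T" by (cases "P c") (auto simp: vpath_def vwalk_def)
  from rooted_rep_of_vpt_rep[OF T(1) this] obtain p d where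
    "rooted_rep (verts T) q p d (verts H) (\<lambda>u v. (u, v) \<in> arcs_ends H) (\<lambda>v. set (P v))"
    by blast
  from rooted_rep.helly[OF this C False] adj obtain z where z: "z \<in> verts T" "\<forall>c \<in> C. z \<in> set (P c)"
    by blast
  from rooted_rep_of_vpt_rep[OF T(1) z(1)] obtain p' d' where
    R: "rooted_rep (verts T) z p' d' (verts H) (\<lambda>u v. (u, v) \<in> arcs_ends H) (\<lambda>v. set (P v))"
    and deg: "node_degree (verts T) z p' z = out_degree T z"
    using z(1) by blast
  interpret rooted_rep "verts T" z p' d' "verts H" "\<lambda>u v. (u, v) \<in> arcs_ends H" "\<lambda>v. set (P v)"
    by (rule R)
  have "C \<subseteq> root_clique" using C z(2) by (auto simp: root_clique_def)
  then show ?thesis using branch_colourable_of_degree deg T(2) z(1) h by simp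
qed

lemma arcs_ends_del_vert:
  "arcs_ends (pre_digraph.del_vert G w) = {(u, v) \<in> arcs_ends G. u \<noteq> w \<and> v \<noteq> w}"
  by (auto simp: arcs_ends_conv pre_digraph.del_vert_def)

text \<open>Neighbourhoods inside \<open>C - {w}\<close> agree in the graph and in the graph without
  \<open>w\<close>. The case of \<open>w\<close> outside \<open>C\<close> yields that no vertex is
  dominated, the case of \<open>w\<close> in \<open>C\<close> that the clique is unique.\<close>

lemma del_vert_colourable:
  assumes H: "in_h21 h (pre_digraph.del_vert G w)" and h: "0 < h" and C: "C \<subseteq> verts G"
    and adj: "\<And>u v. u \<in> C \<Longrightarrow> v \<in> C \<Longrightarrow> u \<noteq> v \<Longrightarrow> (u, v) \<in> arcs_ends G"
  shows "branch_colourable (\<lambda>u v. (u, v) \<in> arcs_ends G) (verts G - {w}) (C - {w}) h"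
proof -
  have "branch_colourable (\<lambda>u v. (u, v) \<in> arcs_ends (pre_digraph.del_vert G w))
      (verts (pre_digraph.del_vert G w)) (C - {w}) h"
    by (rule clique_colourable_of_h21[OF H h]) (use C adj in \<open>auto simp: arcs_ends_del_vert pre_digraph.verts_del_vert\<close>)
  then obtain f :: "'a \<Rightarrow> nat" where f: "\<forall>u \<in> verts G - {w} - (C - {w}). f u < h \<and>
     (\<forall>v \<in> verts G - {w} - (C - {w}).
        crossing {c \<in> C - {w}. (u, c) \<in> arcs_ends (pre_digraph.del_vert G w)}
          {c \<in> C - {w}. (v, c) \<in> arcs_ends (pre_digraph.del_vert G w)} \<longrightarrow> f u \<noteq> f v)"
    unfolding branch_colourable_def pre_digraph.verts_del_vert by (elim exE)
  have *: "{c \<in> C - {w}. (u, c) \<in> arcs_ends (pre_digraph.del_vert G w)} = {c \<in> C - {w}. (u, c) \<in> arcs_ends G}"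
    if "u \<in> verts G - {w} - (C - {w})" for u
    using that by (auto simp: arcs_ends_del_vert)
  show ?thesis unfolding branch_colourable_def by (intro exI[of _ f]) (use f * in simp)
qed

context rooted_rep
begin

text \<open>If \<open>u\<close> is dominated by \<open>v\<close>, then recolour all vertices dominated by \<open>v\<close>: those in the branch of
  \<open>v\<close> get the colour of \<open>v\<close>, and the others, which are pairwise not crossing, a second colour.\<close>

lemma dominated_colourable:
  assumes u: "u \<in> V - root_clique" and v: "v \<in> V - root_clique" and uv: "u \<noteq> v"
    and dom: "{c \<in> root_clique. adj u c} \<subseteq> {c \<in> root_clique. adj v c}" and h: "2 \<le> h"
    and col: "branch_colourable adj (V - {u}) root_clique h"
  shows "branch_colourable adj V root_clique h"
proof -
  define nb br where "nb x = {c \<in> root_clique. adj x c}" and "br x = branch (apex x)" for x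
  obtain f :: "'v \<Rightarrow> nat" where f: "\<And>x. x \<in> V - root_clique \<Longrightarrow> x \<noteq> u \<Longrightarrow> f x < h"
      "\<And>x y. x \<in> V - root_clique \<Longrightarrow> y \<in> V - root_clique \<Longrightarrow> x \<noteq> u \<Longrightarrow> y \<noteq> u \<Longrightarrow>
        crossing (nb x) (nb y) \<Longrightarrow> f x \<noteq> f y"
  proof -
    obtain f :: "'v \<Rightarrow> nat" where "\<forall>x \<in> V - {u} - root_clique. f x < h \<and>
        (\<forall>y \<in> V - {u} - root_clique. crossing (nb x) (nb y) \<longrightarrow> f x \<noteq> f y)"
      using col unfolding branch_colourable_def nb_def by (elim exE)
    then show ?thesis by (intro that[of f]) auto
  qed
  define k where "k = (if f v = 0 then 1 else 0 :: nat)"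
  have k: "k < h" "k \<noteq> f v" using h by (auto simp: k_def)
  \<comment> \<open>The vertex \<open>u\<close> falls under the first case, so its missing colour
    under \<open>f\<close> is never consulted.\<close>
  define g where "g x = (if nb x \<subseteq> nb v then if br x = br v then f v else k else f x)" for x
  have same: "\<not> crossing (nb x) (nb y)"
    if "x \<in> V - root_clique" "y \<in> V - root_clique" "br x = br y" for x y
    using nbh_nested_branch[OF that(1,2)] that(3) by (simp add: nb_def br_def)
  have two: "br x = br y \<or> br x = br z \<or> br y = br z"
    if "x \<in> V - root_clique" "y \<in> V - root_clique" "z \<in> V - root_clique"
      "c \<in> nb x" "c \<in> nb y" "c \<in> nb z" for x y z c
    using two_branches[OF _ that(1-3), of c] that(4-6) by (simp add: nb_def br_def)
  \<comment> \<open>Here \<open>y\<close> crosses both \<open>x\<close> and \<open>v\<close>, so it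
    is in the branch of neither. The path of a common neighbour enters at most two branches, hence
    \<open>x\<close> is in that of \<open>v\<close> and has its colour.\<close>
  have out: "g x \<noteq> g y" if x: "x \<in> V - root_clique" and y: "y \<in> V - root_clique"
    and cr: "crossing (nb x) (nb y)" and xd: "nb x \<subseteq> nb v" and yd: "\<not> nb y \<subseteq> nb v" for x y
  proof -
    obtain c where c: "c \<in> nb x" "c \<in> nb y" using cr unfolding crossing_def by blast
    have "\<not> nb v \<subseteq> nb y" using cr xd unfolding crossing_def by blast
    then have yv: "crossing (nb y) (nb v)" using c xd yd unfolding crossing_def by blast
    have "br x = br v"
      using two[OF x y v c] c xd same[OF x y] same[OF y v] cr yv by auto
    moreover have "y \<noteq> u" using yd dom by (auto simp: nb_def)
    ultimately show ?thesis using f(2)[OF y v _ _ yv] uv xd yd by (auto simp: g_def)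
  qed
  have "g x \<noteq> g y" if x: "x \<in> V - root_clique" and y: "y \<in> V - root_clique"
    and cr: "crossing (nb x) (nb y)" for x y
  proof -
    consider "nb x \<subseteq> nb v" "nb y \<subseteq> nb v" | "nb x \<subseteq> nb v" "\<not> nb y \<subseteq> nb v"
      | "\<not> nb x \<subseteq> nb v" "nb y \<subseteq> nb v" | "\<not> nb x \<subseteq> nb v" "\<not> nb y \<subseteq> nb v" by blast
    then show ?thesis
    proof cases
      case 1
      obtain c where c: "c \<in> nb x" "c \<in> nb y" using cr unfolding crossing_def by blast
      have "br x \<noteq> br y" using same[OF x y] cr by blast
      \<comment> \<open>The path of \<open>c\<close> enters at most two branches, so exactly one of
        \<open>x\<close> and \<open>y\<close> shares the branch of \<open>v\<close>; the other gets
        \<open>k\<close>.\<close>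
      then have "br x = br v \<longleftrightarrow> br y \<noteq> br v" using two[OF x y v c] c 1 by auto
      then show ?thesis using 1 k by (auto simp: g_def)
    next
      case 2
      then show ?thesis using out[OF x y cr] by simp
    next
      case 3
      then show ?thesis using out[OF y x crossing_sym[OF cr]] by simp
    next
      case 4
      then have "x \<noteq> u" "y \<noteq> u" using dom by (auto simp: nb_def)
      then show ?thesis using 4 f(2)[OF x y _ _ cr] by (simp add: g_def)
    qed
  qed
  moreover have "g x < h" if "x \<in> V - root_clique" for x
  proof -
    have "x \<noteq> u" if "\<not> nb x \<subseteq> nb v" using that dom by (auto simp: nb_def)
    then show ?thesis using f(1)[OF that] f(1)[OF v] k uv by (auto simp: g_def)
  qed
  ultimately show ?thesis
    unfolding branch_colourable_def nb_def[symmetric] by (intro exI[of _ g]) simp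
qed

end

theorem theorem15:
  fixes G :: "('a, 'b) pre_digraph" and h :: nat
  assumes "graph G" and "Digraph_Component.connected G"
    and "VPT G"
    and "h \<ge> 3"
    and "minimal_non_h21 h G"
  shows "split_graph G \<and>
    (\<forall>S K. split_partition G S K \<longrightarrow> \<not> (\<exists>s. dominated_stable_vertex G S s))"
proof -
  let ?adj = "\<lambda>u v. (u, v) \<in> arcs_ends G"
  let ?V = "verts G"
  interpret G: graph G by fact
  have irrefl: "\<not> ?adj u u" for u using G.adj_not_same by blast
  have nh: "\<not> in_h21 h G" and del: "\<And>w. w \<in> ?V \<Longrightarrow> in_h21 h (pre_digraph.del_vert G w)"
    using assms(5) by (auto simp: minimal_non_h21_def)
  have h: "0 < h" "2 \<le> h" using assms(4) by auto
  obtain N :: "nat set" and q p d X where R: "rooted_rep N q p d ?V ?adj X"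
      and unc: "\<not> branch_colourable ?adj ?V {v \<in> ?V. q \<in> X v} h"
    using reduction_to_uncolourable_root[OF assms(3) nh assms(4)] by (elim exE conjE)
  interpret rooted_rep N q p d ?V ?adj X by fact
  define C where "C = root_clique"
  have unc: "\<not> branch_colourable ?adj ?V C h" using unc by (simp add: C_def root_clique_def)
  have CV: "C \<subseteq> ?V" by (auto simp: C_def root_clique_def)
  have Cadj: "?adj u v" if "u \<in> C" "v \<in> C" "u \<noteq> v" for u v
    using that rep_adj[of u v] by (auto simp: C_def root_clique_def)
  have colw: "branch_colourable ?adj (?V - {w}) (C - {w}) h" if "w \<in> ?V" for w
    using del_vert_colourable[OF del[OF that] h(1) CV] Cadj by blast
  \<comment> \<open>Deleting \<open>u\<close> outside \<open>C\<close> leaves the clique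
    \<open>C\<close> intact, so minimality gives a colouring that
    \<open>dominated_colourable\<close> would extend to \<open>u\<close>.\<close>
  have undominated: "\<not> {c \<in> C. ?adj u c} \<subseteq> {c \<in> C. ?adj v c}"
    if uv: "u \<in> ?V - C" "v \<in> ?V - C" "u \<noteq> v" for u v
  proof
    assume "{c \<in> C. ?adj u c} \<subseteq> {c \<in> C. ?adj v c}"
    moreover have "C - {u} = C" using uv by auto
    ultimately show False
      using dominated_colourable[of u v h] uv h colw[of u] unc by (simp add: C_def)
  qed
  have "stable_set G (?V - C)"
    unfolding stable_set_def
  proof (intro conjI ballI)
    fix u v assume uv: "u \<in> ?V - C" "v \<in> ?V - C"
    show "(u, v) \<notin> arcs_ends G"
    proof
      assume a: "?adj u v"
      then have "u \<noteq> v" using irrefl by auto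
      with nbh_nested_adjacent[of u v] uv a undominated[OF uv] undominated[OF uv(2,1)]
      show False by (auto simp: C_def)
    qed
  qed auto
  then have stable0: "\<And>u v. u \<in> ?V - C \<Longrightarrow> v \<in> ?V - C \<Longrightarrow> \<not> ?adj u v"
    and split0: "split_partition G (?V - C) C"
    using CV Cadj by (auto simp: split_partition_def clique_def stable_set_def)
  have "\<not> dominated_stable_vertex G S s" if SK: "split_partition G S K" for S K s
  proof -
    have S: "S \<subseteq> ?V" "\<And>u v. u \<in> S \<Longrightarrow> v \<in> S \<Longrightarrow> \<not> ?adj u v"
      and K: "\<And>u v. u \<in> K \<Longrightarrow> v \<in> K \<Longrightarrow> u \<noteq> v \<Longrightarrow> ?adj u v"
      and part: "\<And>x. x \<in> ?V \<Longrightarrow> x \<in> S \<or> x \<in> K" "S \<inter> K = {}" "K \<subseteq> ?V"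
      using SK by (auto simp: split_partition_def stable_set_def clique_def)
    text \<open>A vertex of \<open>C \<inter> S\<close> has at most one neighbour outside \<open>C\<close>, so it never witnesses a crossing.\<close>
    have "x \<notin> S" if x: "x \<in> C" for x
    proof
      assume xS: "x \<in> S"
      have xK: "a \<in> K" if "a \<in> ?V" "?adj a x" for a
        using part(1)[OF that(1)] S(2)[OF _ xS, of a] that(2) by blast
      have cr: "crossing {c \<in> C - {x}. ?adj a c} {c \<in> C - {x}. ?adj b c}"
        if ab: "a \<in> ?V - C" "b \<in> ?V - C" and cr: "crossing {c \<in> C. ?adj a c} {c \<in> C. ?adj b c}" for a b
      proof -
        have "a \<noteq> b" using cr by (auto simp: crossing_def)
        obtain c y z where c: "c \<in> C" "?adj a c" "?adj b c" and y: "y \<in> C" "?adj a y" "\<not> ?adj b y"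
          and z: "z \<in> C" "?adj b z" "\<not> ?adj a z"
          using cr unfolding crossing_def by blast
        \<comment> \<open>Two vertices outside \<open>C\<close> are nonadjacent, so not both are in
          \<open>K\<close>; but all neighbours of \<open>x\<close> are in \<open>K\<close>, so
          \<open>x\<close> is not the common neighbour \<open>c\<close>.\<close>
        have nK: "\<not> (a \<in> K \<and> b \<in> K)" using K[of a b] stable0[OF ab] \<open>a \<noteq> b\<close> by blast
        have "c \<noteq> x" using xK[of a] xK[of b] ab c nK by auto
        \<comment> \<open>A neighbour \<open>e\<close> of \<open>x\<close> is in \<open>K\<close>,
          so a nonneighbour \<open>w\<close> of \<open>e\<close> in \<open>C\<close> is in
          \<open>S\<close>. Both \<open>w\<close> and \<open>x\<close> are then in the clique
          \<open>C\<close> and in the stable set \<open>S\<close>, hence equal.\<close>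
        moreover have *: "w = x" if "e \<in> ?V - C" "?adj e x" "w \<in> C" "\<not> ?adj e w" for e w
        proof -
          have "e \<in> K" using xK that by blast
          moreover have "w \<noteq> e" using that by blast
          ultimately have "w \<in> S" using K[of e w] that part(1)[of w] CV by blast
          then show "w = x" using Cadj[OF that(3) x] S(2)[OF _ xS] by blast
        qed
        have "y \<noteq> x" using *[OF ab(1) _ z(1,3)] y z by blast
        moreover have "z \<noteq> x" using *[OF ab(2) _ y(1,3)] y z by blast
        ultimately show ?thesis using c y z unfolding crossing_def by blast
      qed
      \<comment> \<open>Since crossings survive the removal of \<open>x\<close> from
        \<open>C\<close>, the colouring obtained by deleting \<open>x\<close> is one for
        \<open>C\<close>.\<close>
      have "?V - {x} - (C - {x}) = ?V - C" using x by auto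
      then have "branch_colourable ?adj ?V C h"
        using colw[of x] x CV cr unfolding branch_colourable_def by (smt (verit) subsetD)
      then show False using unc by simp
    qed
    then have CK: "C \<subseteq> K" using part(1) CV by blast
    \<comment> \<open>A vertex of \<open>K\<close> outside \<open>C\<close> is adjacent to all of
      \<open>C\<close> and would dominate every other vertex outside \<open>C\<close>. So it is the
      only one there, and the constant colouring 0 contradicts \<open>unc\<close>.\<close>
    have "K \<subseteq> C"
    proof
      fix x assume x: "x \<in> K"
      show "x \<in> C"
      proof (rule ccontr)
        assume xC: "x \<notin> C"
        then have full: "{c \<in> C. ?adj x c} = C" using K[OF x] CK by blast
        have "a = x" if "a \<in> ?V - C" for a
          using undominated[of a x] that x part(3) xC full by blast
        then have "branch_colourable ?adj ?V C h"
          unfolding branch_colourable_def using h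
          by (intro exI[of _ "\<lambda>_. 0"]) (auto simp: crossing_def)
        then show False using unc by simp
      qed
    qed
    then have "S = ?V - C" using CK part S(1) by blast
    then show ?thesis
      using undominated unfolding dominated_stable_vertex_def neighbors_def by blast
  qed
  then show ?thesis using split0 unfolding split_graph_def by blast
qed

end
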